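(* Let $0<\sigma<1$ and $\rho>0$. Then for every $x>0$, $$\phi(\rho\sigma,0;\pm x)=\int_0^\infty\phi(-\sigma,0;-s)\,\phi(\rho,0;\pm xs^{\rho})\,\frac{ds}{s},$$ where either the upper signs or the lower signs are taken throughout (both identities hold).
   Context: For real $\rho\in(-1,0)\cup(0,\infty)$ and real $z$, the reduced Wright function is $\phi(\rho,0;z)=\sum_{n=1}^\infty \frac{z^n}{n!\,\Gamma(\rho n)}$, where $1/\Gamma$ is the entire reciprocal gamma function (equal to $0$ at $0,-1,-2,\ldots$). *)

theory Defs
  imports "HOL-Analysis.Analysis"
begin

text \<open>
  The reduced Wright function \<open>\<phi>(\<rho>, 0; z)\<close>, the sum over \<open>n \<ge> 1\<close> of
  \<open>z^n / (n! \<Gamma>(\<rho> n))\<close>; the summation index is shifted by one. The library function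
  \<^const>\<open>rGamma\<close> is the entire reciprocal gamma function, zero at \<open>0, -1, -2, \<dots>\<close>.
  The parameter is meant to lie in \<open>(-1, 0) \<union> (0, \<infinity>)\<close>, where the series converges for
  every \<open>z\<close>.
\<close>

definition wright0 :: "real \<Rightarrow> real \<Rightarrow> real" where
  "wright0 \<rho> z = (\<Sum>n. z ^ Suc n * rGamma (\<rho> * real (Suc n)) / fact (Suc n))"

end

theory Submission
  imports Defs
begin

text \<open>
  The Mellin transform of \<open>\<phi>(-\<sigma>, 0; -s)\<close> is \<open>\<Gamma>(a) / \<Gamma>(\<sigma> a)\<close>, so integrating the series of
  \<open>\<phi>(\<rho>, 0; y s\<^sup>\<rho>) / s\<close> term by term replaces each \<open>1 / \<Gamma>(\<rho> n)\<close> by \<open>1 / \<Gamma>(\<rho> \<sigma> n)\<close>.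
  Everything rests on Hankel's formula \<open>\<pi> / \<Gamma>(z) = Im \<integral> exp t * t powr (-z) dt\<close> over the ray \<open>t = 1 + r cis \<theta>\<close>
  with \<open>\<theta> > \<pi>/2\<close>: summed over \<open>z = -\<sigma> n\<close> it gives
  \<open>\<pi> \<phi>(-\<sigma>, 0; -s) = Im \<integral> exp (t - s t\<^sup>\<sigma>) dt\<close>. If moreover \<open>\<sigma> \<theta> < \<pi>/2\<close>, then \<open>Re t\<^sup>\<sigma>\<close> has a
  positive lower bound \<open>\<delta>\<close> on the ray, so this function is \<open>O(exp (- \<delta> s))\<close>, which justifies all
  interchanges. Starting the ray at \<open>1\<close> rather than \<open>0\<close> is what produces the exponential decay.
\<close>

section \<open>Laplace integrals of powers\<close>

abbreviation halfline :: "real measure" where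
  "halfline \<equiv> restrict_space lborel {0<..}"

lemma sigma_finite_halfline: "sigma_finite_measure halfline"
  by (rule sigma_finite_measure_restrict_space) (auto simp: sigma_finite_lborel)

lemma integrable_halfline_iff:
  fixes f :: "real \<Rightarrow> 'a::{banach, second_countable_topology}"
  shows "integrable halfline f \<longleftrightarrow> set_integrable lborel {0<..} f"
  by (simp add: integrable_restrict_space set_integrable_def)

lemma integral_halfline:
  fixes f :: "real \<Rightarrow> 'a::{banach, second_countable_topology}"
  shows "integral\<^sup>L halfline f = (LBINT s:{0<..}. f s)"
  by (simp add: integral_restrict_space set_lebesgue_integral_def)

lemma has_bochner_integral_halfline_iff:
  fixes f :: "real \<Rightarrow> 'a::{banach, second_countable_topology}"
  shows "has_bochner_integral halfline f I \<longleftrightarrow>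
    has_bochner_integral lborel (\<lambda>s. indicator {0<..} s *\<^sub>R f s) I"
  by (simp add: has_bochner_integral_iff integrable_restrict_space integral_restrict_space)

lemma space_halfline [simp]: "space halfline = {0<..}"
  by (simp add: space_restrict_space)

section \<open>Measurability of complex powers\<close>

lemma borel_measurable_ident_restrict [measurable]: "(\<lambda>x. x) \<in> borel_measurable (restrict_space borel A)"
  by (intro measurable_restrict_space1) simp

text \<open>The plane is cut into the origin, the open negative axis and the slit plane. On the
  negative axis \<open>Ln z\<close> is \<open>ln (norm z) + \<i> * pi\<close>, so \<open>Ln\<close>
  is continuous on each piece although it jumps across the cut.\<close>

lemma borel_measurable_Ln [measurable]: "(Ln :: complex \<Rightarrow> complex) \<in> borel_measurable borel"
proof (rule measurable_piecewise_restrict[of "{{0}, \<real>\<^sub>\<le>\<^sub>0 - {0}, - \<real>\<^sub>\<le>\<^sub>0}"])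
  show "\<Omega> \<inter> space borel \<in> sets borel" if "\<Omega> \<in> {{0}, \<real>\<^sub>\<le>\<^sub>0 - {0}, - \<real>\<^sub>\<le>\<^sub>0}" for \<Omega> :: "complex set"
    using that closed_nonpos_Reals_complex by (auto intro: borel_closed)
  have "(Ln :: complex \<Rightarrow> complex) \<in> borel_measurable (restrict_space borel (\<real>\<^sub>\<le>\<^sub>0 - {0}))"
  proof (rule borel_measurable_continuous_on_restrict)
    have "continuous_on (\<real>\<^sub>\<le>\<^sub>0 - {0}) (\<lambda>z::complex. of_real (ln (norm z)) + \<i> * of_real pi)"
      by (intro continuous_intros) auto
    moreover have "Ln z = of_real (ln (norm z)) + \<i> * of_real pi" if "z \<in> \<real>\<^sub>\<le>\<^sub>0 - {0}" for z :: complex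
    proof -
      obtain x where "z = of_real x" "x < 0"
        using \<open>z \<in> \<real>\<^sub>\<le>\<^sub>0 - {0}\<close> by (auto elim!: nonpos_Reals_cases simp: less_le)
      then show ?thesis
        using Ln_of_real'[of x] by simp
    qed
    ultimately show "continuous_on (\<real>\<^sub>\<le>\<^sub>0 - {0}) (Ln :: complex \<Rightarrow> complex)"
      using continuous_on_cong[OF refl] by (metis (no_types, lifting))
  qed
  moreover have "(Ln :: complex \<Rightarrow> complex) \<in> borel_measurable (restrict_space borel (- \<real>\<^sub>\<le>\<^sub>0))"
    by (intro borel_measurable_continuous_on_restrict continuous_on_Ln) auto
  moreover have "(Ln :: complex \<Rightarrow> complex) \<in> borel_measurable (restrict_space borel {0})"
    by (intro borel_measurable_continuous_on_restrict) auto
  ultimately show "Ln \<in> borel_measurable (restrict_space borel \<Omega>)"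
    if "\<Omega> \<in> {{0}, \<real>\<^sub>\<le>\<^sub>0 - {0}, - \<real>\<^sub>\<le>\<^sub>0}" for \<Omega> :: "complex set"
    using that by blast
qed auto

lemma borel_measurable_powr_complex [measurable]:
  fixes b :: complex
  assumes [measurable]: "f \<in> borel_measurable M"
  shows "(\<lambda>x. f x powr b) \<in> borel_measurable M"
  unfolding powr_def by measurable

section \<open>Gamma integrals with real and complex rates\<close>

lemma Gamma_rate_real:
  fixes a c :: real
  assumes "0 < a" "0 < c"
  shows "has_bochner_integral halfline (\<lambda>s. s powr (a - 1) * exp (- c * s)) (Gamma a * c powr (- a))"
proof -
  let ?f = "\<lambda>t::real. indicator {0<..} t * (t powr (a - 1) * exp (- t))"
  have "has_bochner_integral lborel ?f (Gamma a)"
  proof (rule has_bochner_integral_nn_integral)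
    have "Gamma a = nn_integral lborel (\<lambda>t. ennreal (indicator {0..} t * t powr (a - 1) / exp t))"
      using Gamma_conv_nn_integral_real[OF assms(1)] .
    also have "\<dots> = nn_integral lborel (\<lambda>t. ennreal (?f t))"
      by (intro nn_integral_cong_AE AE_I[of _ _ "{0}"])
         (auto simp: indicator_def exp_minus field_simps split: if_splits)
    finally show "nn_integral lborel (\<lambda>t. ennreal (?f t)) = ennreal (Gamma a)" ..
  qed (use assms in \<open>auto simp: Gamma_real_pos less_imp_le\<close>)
  \<comment> \<open>This substitutes \<open>t = c * s\<close> in Euler's integral. The factor
    \<open>c powr (1 - a)\<close> brought in next cancels the \<open>c powr (a - 1)\<close> that the
    substitution leaves in the integrand.\<close>
  then have "has_bochner_integral lborel (\<lambda>s. ?f (0 + c * s)) (Gamma a /\<^sub>R \<bar>c\<bar>)"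
    using lborel_has_bochner_integral_real_affine_iff[of c ?f "Gamma a" 0] assms by simp
  from has_bochner_integral_mult_right[OF this, of "c powr (1 - a)"]
  have "has_bochner_integral lborel (\<lambda>s. c powr (1 - a) * ?f (0 + c * s)) (c powr (1 - a) * (Gamma a /\<^sub>R \<bar>c\<bar>))"
    by simp
  also have "(\<lambda>s. c powr (1 - a) * ?f (0 + c * s)) =
      (\<lambda>s. indicator {0<..} s *\<^sub>R (s powr (a - 1) * exp (- c * s)))"
  proof
    fix s :: real
    show "c powr (1 - a) * ?f (0 + c * s) = indicator {0<..} s *\<^sub>R (s powr (a - 1) * exp (- c * s))"
    proof (cases "s > 0")
      case True
      have "c powr (1 - a) * c powr (a - 1) = 1"
        using assms by (simp flip: powr_add)
      then show ?thesis
        using assms True by (simp add: powr_mult)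
    qed (use assms in \<open>auto simp: zero_less_mult_iff\<close>)
  qed
  also have "c powr (1 - a) * (Gamma a /\<^sub>R \<bar>c\<bar>) = Gamma a * c powr (- a)"
    using assms by (simp add: powr_diff powr_minus field_simps)
  finally show ?thesis
    by (simp only: has_bochner_integral_halfline_iff)
qed

text \<open>
  Expand around a real rate \<open>c\<close> with \<open>\<bar>c - p\<bar> < c\<close>, such as \<open>\<bar>p\<bar>\<^sup>2 / Re p\<close>; the result is a binomial
  series.
\<close>

lemma Gamma_rate_complex:
  fixes a :: real and p :: complex
  assumes "0 < a" "0 < Re p"
  shows "has_bochner_integral halfline (\<lambda>s. of_real (s powr (a - 1)) * exp (- of_real s * p))
           (of_real (Gamma a) * p powr (- of_real a))"
proof -
  define c where "c = (norm p)\<^sup>2 / Re p"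
  define d where "d = of_real c - p"
  define f where "f = (\<lambda>n s. d ^ n / fact n * of_real (s powr (a + n - 1) * exp (- c * s)))"
  have "p \<noteq> 0"
    using assms by auto
  then have "0 < c"
    using assms by (simp add: c_def)
  have "(norm d)\<^sup>2 = c\<^sup>2 - 2 * c * Re p + (norm p)\<^sup>2"
    unfolding cmod_power2 by (simp add: d_def power2_eq_square algebra_simps)
  also have "\<dots> < c\<^sup>2"
    using \<open>0 < c\<close> assms \<open>p \<noteq> 0\<close> by (simp add: c_def)
  finally have "norm d < c"
    using \<open>0 < c\<close> by (simp add: power2_less_imp_less)
  have f_int: "has_bochner_integral halfline (f n) (d ^ n / fact n * of_real (Gamma (a + n) * c powr (- (a + n))))" for n
    unfolding f_def
    by (intro has_bochner_integral_mult_right has_bochner_integral_of_real Gamma_rate_real)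
       (use assms \<open>0 < c\<close> in auto)
  have f_norm_int: "(\<integral>s. norm (f n s) \<partial>halfline) = norm d ^ n / fact n * (Gamma (a + n) * c powr (- (a + n)))" for n
  proof -
    have "has_bochner_integral halfline (\<lambda>s. norm d ^ n / fact n * (s powr (a + n - 1) * exp (- c * s)))
        (norm d ^ n / fact n * (Gamma (a + n) * c powr (- (a + n))))"
      by (intro has_bochner_integral_mult_right Gamma_rate_real) (use assms \<open>0 < c\<close> in auto)
    moreover have "norm (f n s) = norm d ^ n / fact n * (s powr (a + n - 1) * exp (- c * s))" for s
      by (simp add: f_def norm_mult norm_divide norm_power)
    ultimately show ?thesis
      by (simp only: has_bochner_integral_integral_eq)
  qed
  \<comment> \<open>\<open>Gamma (a + n) / Gamma a\<close> is a rising factorial, hence up to sign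
    \<open>fact n\<close> times a binomial coefficient of \<open>- a\<close>. So the integrated
    terms form a binomial series.\<close>
  have coeff: "Gamma (a + n) * c powr (- (a + n)) / fact n =
      Gamma a * c powr (- a) * ((- a) gchoose n) * (- 1 / c) ^ n" for n
  proof -
    have "a \<notin> \<int>\<^sub>\<le>\<^sub>0"
      using nonpos_Ints_nonpos[of a] assms by linarith
    then have "Gamma (a + n) = Gamma a * pochhammer a n"
      using pochhammer_Gamma[of a n] by (simp add: Gamma_eq_zero_iff)
    moreover have "c powr (- (a + n)) = c powr (- a) * (1 / c) ^ n"
      using \<open>0 < c\<close> by (simp add: powr_diff powr_realpow power_divide)
    moreover have "(- 1 :: real) ^ n * (- 1 / c) ^ n = (1 / c) ^ n"
      by (simp flip: power_mult_distrib)
    ultimately show ?thesis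
      by (simp add: gbinomial_pochhammer)
  qed
  \<comment> \<open>In \<open>exp (- s * p) = exp (- c * s) * exp (d * s)\<close> only the second
    factor is expanded; the first keeps every term integrable.\<close>
  have sums_f: "(\<lambda>n. f n s) sums (of_real (s powr (a - 1)) * exp (- of_real s * p))" if "s > 0" for s
  proof -
    have "(\<lambda>n. of_real (s powr (a - 1) * exp (- c * s)) * ((d * of_real s) ^ n /\<^sub>R fact n)) sums
        (of_real (s powr (a - 1) * exp (- c * s)) * exp (d * of_real s))"
      by (intro sums_mult exp_converges)
    moreover have "of_real (s powr (a - 1) * exp (- c * s)) * ((d * of_real s) ^ n /\<^sub>R fact n) = f n s" for n
      using that by (simp add: f_def powr_add powr_realpow power_mult_distrib scaleR_conv_of_real
          field_simps powr_diff)
    moreover have "of_real (exp (- c * s)) * exp (d * of_real s) = exp (- of_real s * p)"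
      unfolding exp_of_real[symmetric] exp_add[symmetric] by (simp add: d_def algebra_simps)
    ultimately show ?thesis
      by (simp add: mult.assoc)
  qed
  have summable_f: "summable (\<lambda>n. norm (f n s))" if "s > 0" for s
  proof -
    have "summable (\<lambda>n. s powr (a - 1) * exp (- c * s) * (norm ((norm d * s) ^ n /\<^sub>R fact n)))"
      by (intro summable_mult summable_norm_exp)
    moreover have "s powr (a - 1) * exp (- c * s) * (norm ((norm d * s) ^ n /\<^sub>R fact n)) = norm (f n s)" for n
      using that by (simp add: f_def powr_add powr_realpow power_mult_distrib norm_mult norm_divide norm_power
          field_simps powr_diff abs_mult)
    ultimately show ?thesis
      by (simp only:)
  qed
  \<comment> \<open>Taking norms replaces \<open>d\<close> by \<open>norm d\<close>. The result is
    the binomial series at \<open>- norm d / c\<close>, inside its disc of convergence because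
    \<open>norm d < c\<close>.\<close>
  have binom_norm: "summable (\<lambda>n. \<integral>s. norm (f n s) \<partial>halfline)"
  proof -
    have "summable (\<lambda>n. Gamma a * c powr (- a) * (((- a) gchoose n) * (- norm d / c) ^ n))"
      using gen_binomial_real[of "- norm d / c" "- a"] \<open>norm d < c\<close> \<open>0 < c\<close>
      by (intro summable_mult) (auto simp: sums_iff)
    moreover have "Gamma a * c powr (- a) * (((- a) gchoose n) * (- norm d / c) ^ n) = (\<integral>s. norm (f n s) \<partial>halfline)" for n
    proof -
      have "(\<integral>s. norm (f n s) \<partial>halfline) = norm d ^ n * (Gamma (a + n) * c powr (- (a + n)) / fact n)"
        by (simp add: f_norm_int)
      also have "\<dots> = Gamma a * c powr (- a) * ((- a) gchoose n) * (norm d ^ n * (- 1 / c) ^ n)"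
        by (simp only: coeff mult_ac)
      also have "norm d ^ n * (- 1 / c) ^ n = (- norm d / c) ^ n"
        by (simp flip: power_mult_distrib)
      finally show ?thesis by simp
    qed
    ultimately show ?thesis by (simp only:)
  qed
  have "(\<lambda>n. of_real (Gamma a * c powr (- a)) * ((of_real (- a) gchoose n) * (- d / of_real c) ^ n)) sums
      (of_real (Gamma a * c powr (- a)) * (1 + - d / of_real c) powr of_real (- a))"
    using \<open>norm d < c\<close> \<open>0 < c\<close> by (intro sums_mult gen_binomial_complex) (simp add: norm_divide)
  moreover have "of_real (Gamma a * c powr (- a)) * ((of_real (- a) gchoose n) * (- d / of_real c) ^ n) =
      integral\<^sup>L halfline (f n)" for n
  proof -
    have "integral\<^sup>L halfline (f n) = d ^ n * of_real (Gamma (a + n) * c powr (- (a + n)) / fact n)"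
      by (simp add: has_bochner_integral_integral_eq[OF f_int])
    also have "\<dots> = of_real (Gamma a * c powr (- a)) * of_real ((- a) gchoose n) * (d ^ n * of_real (- 1 / c) ^ n)"
      by (simp only: coeff of_real_mult of_real_power mult_ac)
    also have "d ^ n * of_real (- 1 / c) ^ n = (- d / of_real c) ^ n"
      by (simp flip: power_mult_distrib)
    also have "complex_of_real ((- a) gchoose n) = of_real (- a) gchoose n"
      by (simp add: gbinomial_prod_rev)
    finally show ?thesis by (simp only: mult.assoc)
  qed
  ultimately have 1: "(\<lambda>n. integral\<^sup>L halfline (f n)) sums
      (of_real (Gamma a * c powr (- a)) * (1 + - d / of_real c) powr of_real (- a))"
    by (simp only:)
  \<comment> \<open>The power of \<open>p / c\<close> splits without a branch correction because
    \<open>1 / c\<close> is a positive real.\<close>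
  have "1 + - d / of_real c = of_real (1 / c) * p"
    using \<open>0 < c\<close> by (simp add: d_def field_simps)
  also have "\<dots> powr of_real (- a) = of_real (1 / c) powr of_real (- a) * p powr of_real (- a)"
    using \<open>0 < c\<close> by (intro powr_times_real_left) auto
  also have "of_real (1 / c) powr of_real (- a) = complex_of_real (c powr a)"
    using \<open>0 < c\<close> by (subst powr_of_real) (auto simp: powr_divide powr_minus)
  finally have 2: "of_real (Gamma a * c powr (- a)) * (1 + - d / of_real c) powr of_real (- a) =
      of_real (Gamma a) * p powr (- of_real a)"
    using \<open>0 < c\<close> by (simp add: powr_minus field_simps)
  have int: "integrable halfline (f n)" for n
    using f_int has_bochner_integral_iff by blast
  have AE: "AE s in halfline. summable (\<lambda>n. norm (f n s))"
    by (rule AE_I2) (simp add: summable_f)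
  have "integrable halfline (\<lambda>s. \<Sum>n. f n s)"
    by (rule integrable_suminf[OF int AE binom_norm])
  moreover have "(\<integral>s. (\<Sum>n. f n s) \<partial>halfline) = of_real (Gamma a) * p powr (- of_real a)"
    using sums_unique2[OF sums_integral[OF int AE binom_norm] 1] 2 by simp
  ultimately have "has_bochner_integral halfline (\<lambda>s. \<Sum>n. f n s) (of_real (Gamma a) * p powr (- of_real a))"
    by (simp add: has_bochner_integral_iff)
  then show ?thesis
    by (rule has_bochner_integral_cong[THEN iffD1, rotated -1])
       (auto simp: sums_unique[OF sums_f, symmetric])
qed

text \<open>At \<open>s = 0\<close> both sides vanish thanks to the exponent \<open>Suc n\<close>:
  \<open>0 powr 0\<close> is \<open>0\<close>, whereas \<open>0 ^ 0\<close> is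
  \<open>1\<close>.\<close>

lemma powr_times_Suc: "s powr (b * real (Suc n)) = (s powr b) ^ Suc n" for s b :: real
  by (cases "s = 0") (simp_all add: powr_def mult_ac del: power_Suc of_nat_Suc flip: exp_of_nat_mult)


section \<open>Hankel's formula on an oblique ray\<close>

lemma integral_halfline_FTC:
  fixes F f :: "real \<Rightarrow> 'a::euclidean_space"
  assumes "\<And>r. 0 < r \<Longrightarrow> (F has_vector_derivative f r) (at r)"
    and "\<And>r. 0 < r \<Longrightarrow> isCont f r"
    and "integrable halfline f"
    and "(F \<longlongrightarrow> A) (at_right 0)" and "(F \<longlongrightarrow> B) at_top"
  shows "(\<integral>r. f r \<partial>halfline) = B - A"
proof -
  have "einterval 0 \<infinity> = {0<..}"
    by (auto simp: einterval_def)
  moreover have "(LBINT r=0..\<infinity>. f r) = B - A"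
    using assms \<open>einterval 0 \<infinity> = {0<..}\<close>
    by (intro interval_integral_FTC_integrable[where F = F])
       (auto simp: integrable_halfline_iff ereal_tendsto_simps zero_ereal_def)
  ultimately show ?thesis
    by (simp add: integral_halfline interval_lebesgue_integral_def)
qed

section \<open>Sublinear growth absorbed by small exponentials\<close>

lemma powr_le_affine:
  fixes \<sigma> \<eta> :: real
  assumes "0 < \<sigma>" "\<sigma> < 1" "0 < \<eta>"
  obtains C where "0 \<le> C" "\<And>y. 0 \<le> y \<Longrightarrow> y powr \<sigma> \<le> C + \<eta> * y"
proof
  \<comment> \<open>\<open>Y\<close> is the point where \<open>y powr \<sigma>\<close> and
    \<open>\<eta> * y\<close> cross. Below it the constant \<open>Y powr \<sigma>\<close> suffices,
    above it the linear term does, since \<open>y powr (\<sigma> - 1)\<close> decreases.\<close>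
  define Y where "Y = \<eta> powr (- 1 / (1 - \<sigma>))"
  show "0 \<le> Y powr \<sigma>" by simp
  fix y :: real
  assume "0 \<le> y"
  show "y powr \<sigma> \<le> Y powr \<sigma> + \<eta> * y"
  proof (cases "y \<le> Y")
    case True
    then have "y powr \<sigma> \<le> Y powr \<sigma>"
      using \<open>0 \<le> y\<close> assms by (intro powr_mono2) auto
    then show ?thesis
      using assms \<open>0 \<le> y\<close> by (simp add: add_increasing2)
  next
    case False
    have "0 < Y"
      using assms by (simp add: Y_def)
    have "y powr \<sigma> = y * y powr (\<sigma> - 1)"
      using False \<open>0 < Y\<close> by (simp add: powr_diff)
    also have "\<dots> \<le> y * Y powr (\<sigma> - 1)"
      using False \<open>0 < Y\<close> assms by (intro mult_left_mono powr_mono2') auto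
    also have "Y powr (\<sigma> - 1) = \<eta>"
    proof -
      have "- 1 / (1 - \<sigma>) * (\<sigma> - 1) = 1"
        using assms by (simp add: divide_simps)
      then show ?thesis
        using assms by (simp only: Y_def powr_powr) simp
    qed
    finally have "y powr \<sigma> \<le> \<eta> * y"
      by (simp only: mult.commute)
    then show ?thesis
      by (simp add: add_increasing)
  qed
qed

lemma integrable_exp_neg:
  fixes \<kappa> :: real
  assumes "0 < \<kappa>"
  shows "integrable halfline (\<lambda>r. exp (- \<kappa> * r))"
proof -
  have "integrable halfline (\<lambda>r. r powr (1 - 1) * exp (- \<kappa> * r))"
    using Gamma_rate_real[of 1 \<kappa>] assms by (simp only: has_bochner_integral_iff)
  then show ?thesis
    by (rule Bochner_Integration.integrable_cong[THEN iffD1, OF refl, rotated]) auto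
qed

lemma exp_powr_bound:
  fixes c \<kappa> \<sigma> :: real
  assumes "0 < \<sigma>" "\<sigma> < 1" "0 < \<kappa>"
  obtains C where "\<And>r. 0 \<le> r \<Longrightarrow> exp (c * (1 + r) powr \<sigma>) \<le> C * exp (\<kappa> * r)"
proof -
  \<comment> \<open>The slope is chosen so that \<open>\<bar>c\<bar>\<close> times it is at most
    \<open>\<kappa>\<close>; the summand \<open>1\<close> keeps it defined for
    \<open>c = 0\<close>.\<close>
  obtain D where D: "0 \<le> D" "\<And>y. 0 \<le> y \<Longrightarrow> y powr \<sigma> \<le> D + \<kappa> / (\<bar>c\<bar> + 1) * y"
    using powr_le_affine[of \<sigma> "\<kappa> / (\<bar>c\<bar> + 1)"] assms by auto
  show ?thesis
  proof
    fix r :: real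
    assume "0 \<le> r"
    have "c * (1 + r) powr \<sigma> \<le> \<bar>c\<bar> * (1 + r) powr \<sigma>"
      by (intro mult_right_mono) auto
    also have "\<dots> \<le> \<bar>c\<bar> * (D + \<kappa> / (\<bar>c\<bar> + 1) * (1 + r))"
      using D(2)[of "1 + r"] \<open>0 \<le> r\<close> by (intro mult_left_mono) auto
    also have "\<dots> = \<bar>c\<bar> * D + \<bar>c\<bar> / (\<bar>c\<bar> + 1) * (\<kappa> * (1 + r))"
      by (simp add: field_simps)
    also have "\<dots> \<le> \<bar>c\<bar> * D + 1 * (\<kappa> * (1 + r))"
      using assms \<open>0 \<le> r\<close> by (intro add_left_mono mult_right_mono) auto
    finally show "exp (c * (1 + r) powr \<sigma>) \<le> exp (\<bar>c\<bar> * D + \<kappa>) * exp (\<kappa> * r)"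
      by (simp add: algebra_simps flip: exp_add)
  qed
qed

text \<open>The bound \<open>ln y \<le> 2 * y powr (1 / 2)\<close> turns the power into the
  exponential of a square root, which is the case \<open>\<sigma> = 1 / 2\<close> of
  \<open>exp_powr_bound\<close>.\<close>

lemma powr_exp_bound:
  fixes b \<kappa> :: real
  assumes "0 < \<kappa>"
  obtains C where "\<And>r. 0 \<le> r \<Longrightarrow> (1 + r) powr b \<le> C * exp (\<kappa> * r)"
proof -
  obtain C where C: "\<And>r. 0 \<le> r \<Longrightarrow> exp (2 * \<bar>b\<bar> * (1 + r) powr (1 / 2)) \<le> C * exp (\<kappa> * r)"
    using exp_powr_bound[of "1 / 2" \<kappa> "2 * \<bar>b\<bar>"] assms by auto
  show ?thesis
  proof
    fix r :: real
    assume "0 \<le> r"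
    have "ln ((1 + r) powr (1 / 2)) \<le> (1 + r) powr (1 / 2)"
      using \<open>0 \<le> r\<close> by (intro ln_bound) auto
    then have "ln (1 + r) \<le> 2 * (1 + r) powr (1 / 2)"
      using \<open>0 \<le> r\<close> by (simp add: ln_powr)
    then have "\<bar>b\<bar> * ln (1 + r) \<le> \<bar>b\<bar> * (2 * (1 + r) powr (1 / 2))"
      by (intro mult_left_mono) auto
    moreover have "b * ln (1 + r) \<le> \<bar>b\<bar> * ln (1 + r)"
      using \<open>0 \<le> r\<close> by (intro mult_right_mono) auto
    ultimately have "(1 + r) powr b \<le> exp (2 * \<bar>b\<bar> * (1 + r) powr (1 / 2))"
      using \<open>0 \<le> r\<close> by (simp add: powr_def)
    also note C[OF \<open>0 \<le> r\<close>]
    finally show "(1 + r) powr b \<le> C * exp (\<kappa> * r)" .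
  qed
qed

section \<open>Hankel's integrand along an oblique ray\<close>

definition exp_powr :: "real \<Rightarrow> complex \<Rightarrow> complex" where
  "exp_powr b z = exp z * z powr of_real b"

lemma borel_measurable_exp_powr [measurable]: "exp_powr b \<in> borel_measurable borel"
  unfolding exp_powr_def by measurable

text \<open>Differentiation returns the integrand plus a multiple of the one with exponent
  \<open>b - 1\<close>; the functional equation of \<open>rGamma\<close> will come from
  this.\<close>

lemma has_field_derivative_exp_powr:
  assumes "z \<notin> \<real>\<^sub>\<le>\<^sub>0"
  shows "(exp_powr b has_field_derivative (exp_powr b z + of_real b * exp_powr (b - 1) z)) (at z)"
  unfolding exp_powr_def
  by (rule derivative_eq_intros refl | use assms in \<open>simp add: algebra_simps\<close>)+

lemma isCont_exp_powr:
  assumes "z \<notin> \<real>\<^sub>\<le>\<^sub>0"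
  shows "isCont (exp_powr b) z"
  using has_field_derivative_exp_powr[OF assms] by (rule DERIV_isCont)

lemma norm_exp_powr: "norm (exp_powr b z) = exp (Re z) * norm z powr b"
  by (simp add: exp_powr_def norm_mult norm_powr_real_powr')

text \<open>The bound \<open>pi / 2 < \<theta>\<close> makes \<open>exp\<close> decay along the ray,
  at the rate \<open>\<kappa>\<close>; \<open>\<theta> < pi\<close> keeps the ray off the branch
  cut.\<close>

locale oblique_ray =
  fixes \<theta> :: real
  assumes \<theta>_gt: "pi / 2 < \<theta>" and \<theta>_less: "\<theta> < pi"
begin

abbreviation ray :: "real \<Rightarrow> real \<Rightarrow> complex" where
  "ray v r \<equiv> of_real v + of_real r * cis \<theta>"

definition \<kappa> :: real where "\<kappa> = - cos \<theta>"

lemma \<kappa>_pos: "0 < \<kappa>"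
  using cos_monotone_0_pi[of "pi / 2" \<theta>] \<theta>_gt \<theta>_less by (simp add: \<kappa>_def)

lemma sin_pos: "0 < sin \<theta>"
  using \<theta>_gt \<theta>_less by (intro sin_gt_zero) (auto intro: less_trans[of 0 "pi / 2"])

lemma Re_ray: "Re (ray v r) = v - \<kappa> * r"
  by (simp add: \<kappa>_def)

lemma ray_not_nonpos: "0 < v \<or> 0 < r \<Longrightarrow> 0 \<le> r \<Longrightarrow> ray v r \<notin> \<real>\<^sub>\<le>\<^sub>0"
  using sin_pos by (cases "r = 0") (auto simp: complex_nonpos_Reals_iff)

lemma norm_ray_le: "0 \<le> v \<Longrightarrow> 0 \<le> r \<Longrightarrow> norm (ray v r) \<le> v + r"
  by (rule order_trans[OF norm_triangle_ineq]) (simp add: norm_mult)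

text \<open>\<open>v * sin \<theta>\<close> is the distance from the origin to the line that carries
  the ray.\<close>

lemma norm_ray_ge:
  assumes "0 \<le> v"
  shows "v * sin \<theta> \<le> norm (ray v r)"
proof (rule power2_le_imp_le)
  have "(norm (ray v r))\<^sup>2 = (v + r * cos \<theta>)\<^sup>2 + (r * sin \<theta>)\<^sup>2"
    by (simp add: cmod_power2)
  also have "\<dots> = (v * sin \<theta>)\<^sup>2 + (r + v * cos \<theta>)\<^sup>2"
    using sin_cos_squared_add[of \<theta>] by algebra
  finally show "(v * sin \<theta>)\<^sup>2 \<le> (norm (ray v r))\<^sup>2"
    by simp
qed simp

text \<open>Half of the rate \<open>\<kappa>\<close> is spent on absorbing the power. One constant
  serves all starting points in \<open>[0, 1]\<close>, the origin included, as integration over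
  \<open>v\<close> requires.\<close>

lemma exp_powr_ray_bound_pos:
  assumes "0 \<le> b"
  obtains C where "\<And>v r. \<lbrakk>0 \<le> v; v \<le> 1; 0 \<le> r\<rbrakk> \<Longrightarrow> norm (exp_powr b (ray v r)) \<le> C * exp (- (\<kappa> / 2) * r)"
proof -
  obtain C where C: "\<And>r. 0 \<le> r \<Longrightarrow> (1 + r) powr b \<le> C * exp (\<kappa> / 2 * r)"
    using powr_exp_bound[of "\<kappa> / 2" b] \<kappa>_pos by auto
  show ?thesis
  proof
    fix v r :: real
    assume *: "0 \<le> v" "v \<le> 1" "0 \<le> r"
    have "norm (ray v r) powr b \<le> (1 + r) powr b"
      using * assms norm_ray_le[of v r] by (intro powr_mono2) auto
    also note C[OF *(3)]
    finally have "exp (Re (ray v r)) * norm (ray v r) powr b \<le> exp (1 - \<kappa> * r) * (C * exp (\<kappa> / 2 * r))"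
      unfolding Re_ray using * by (intro mult_mono) auto
    also have "\<dots> = (exp 1 * C) * exp (- (\<kappa> / 2) * r)"
      by (simp add: mult_ac flip: exp_add)
    finally show "norm (exp_powr b (ray v r)) \<le> (exp 1 * C) * exp (- (\<kappa> / 2) * r)"
      unfolding norm_exp_powr .
  qed
qed

text \<open>For negative \<open>b\<close> the power is singular at the origin, so the ray must keep
  its distance and the constant depends on \<open>v\<close>.\<close>

lemma exp_powr_ray_bound:
  assumes "0 < v" "v \<le> 1"
  obtains C where "\<And>r. 0 \<le> r \<Longrightarrow> norm (exp_powr b (ray v r)) \<le> C * exp (- (\<kappa> / 2) * r)"
proof (cases "0 \<le> b")
  case True
  then show ?thesis
    using exp_powr_ray_bound_pos[of b] assms that by (metis less_imp_le)
next
  case False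
  show ?thesis
  proof
    fix r :: real
    assume "0 \<le> r"
    have "norm (ray v r) powr b \<le> (v * sin \<theta>) powr b"
      using False assms sin_pos norm_ray_ge[of v r] by (intro powr_mono2') auto
    moreover have "exp (Re (ray v r)) \<le> exp (v + - (\<kappa> / 2) * r)"
      unfolding Re_ray using \<kappa>_pos \<open>0 \<le> r\<close> by simp
    ultimately have "exp (Re (ray v r)) * norm (ray v r) powr b \<le> exp (v + - (\<kappa> / 2) * r) * (v * sin \<theta>) powr b"
      by (intro mult_mono) auto
    then show "norm (exp_powr b (ray v r)) \<le> (exp v * (v * sin \<theta>) powr b) * exp (- (\<kappa> / 2) * r)"
      unfolding norm_exp_powr exp_add by (simp only: mult_ac)
  qed
qed

lemma integrable_exp_powr_ray:
  assumes "0 < v \<or> 0 \<le> b" "0 \<le> v" "v \<le> 1"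
  shows "integrable halfline (\<lambda>r. exp_powr b (ray v r))"
proof -
  obtain C where C: "\<And>r. 0 \<le> r \<Longrightarrow> norm (exp_powr b (ray v r)) \<le> C * exp (- (\<kappa> / 2) * r)"
    using exp_powr_ray_bound[of v b] exp_powr_ray_bound_pos[of b] assms by metis
  have "integrable halfline (\<lambda>r. C * exp (- (\<kappa> / 2) * r))"
    using integrable_exp_neg[of "\<kappa> / 2"] \<kappa>_pos by (intro integrable_mult_right) auto
  then show ?thesis
  proof (rule Bochner_Integration.integrable_bound)
    show "AE r in halfline. norm (exp_powr b (ray v r)) \<le> norm (C * exp (- (\<kappa> / 2) * r))"
    proof (rule AE_I2)
      fix r :: real
      assume "r \<in> space halfline"
      then have "norm (exp_powr b (ray v r)) \<le> C * exp (- (\<kappa> / 2) * r)"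
        by (intro C) auto
      then show "norm (exp_powr b (ray v r)) \<le> norm (C * exp (- (\<kappa> / 2) * r))"
        unfolding real_norm_def by linarith
    qed
  qed measurable
qed

text \<open>The integrand is the \<open>r\<close>-derivative of \<open>exp_powr b (ray v r)\<close>,
  which vanishes at infinity. The boundary value at \<open>r = 0\<close> is real, so taking
  imaginary parts removes it.\<close>

lemma integral_exp_powr_deriv:
  assumes "0 < v" "v \<le> 1"
  shows "(\<integral>r. (exp_powr b (ray v r) + of_real b * exp_powr (b - 1) (ray v r)) * cis \<theta> \<partial>halfline) =
    - of_real (exp v * v powr b)"
proof -
  obtain C where C: "\<And>r. 0 \<le> r \<Longrightarrow> norm (exp_powr b (ray v r)) \<le> C * exp (- (\<kappa> / 2) * r)"
    using exp_powr_ray_bound assms by metis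
  have isCont: "isCont (\<lambda>r. exp_powr b (ray v r)) r" if "0 \<le> r" for r b
    by (rule isCont_o2[OF _ isCont_exp_powr]) (use that assms ray_not_nonpos in \<open>auto intro!: continuous_intros\<close>)
  have "(\<integral>r. (exp_powr b (ray v r) + of_real b * exp_powr (b - 1) (ray v r)) * cis \<theta> \<partial>halfline) =
      0 - exp_powr b (ray v 0)"
  proof (rule integral_halfline_FTC)
    fix r :: real
    assume "0 < r"
    then have "ray v r \<notin> \<real>\<^sub>\<le>\<^sub>0"
      using ray_not_nonpos by auto
    then show "((\<lambda>r. exp_powr b (ray v r)) has_vector_derivative
        (exp_powr b (ray v r) + of_real b * exp_powr (b - 1) (ray v r)) * cis \<theta>) (at r)"
      by (intro has_vector_derivative_real_field DERIV_chain2[OF has_field_derivative_exp_powr])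
         (auto intro!: derivative_eq_intros)
    show "isCont (\<lambda>r. (exp_powr b (ray v r) + of_real b * exp_powr (b - 1) (ray v r)) * cis \<theta>) r"
      using \<open>0 < r\<close> by (intro continuous_intros isCont) auto
  next
    show "integrable halfline (\<lambda>r. (exp_powr b (ray v r) + of_real b * exp_powr (b - 1) (ray v r)) * cis \<theta>)"
      by (intro integrable_mult_left Bochner_Integration.integrable_add integrable_mult_right integrable_exp_powr_ray)
         (use assms in auto)
    show "((\<lambda>r. exp_powr b (ray v r)) \<longlongrightarrow> exp_powr b (ray v 0)) (at_right 0)"
      using isCont[of 0 b] unfolding isCont_def filterlim_at_split by auto
    have "filterlim (\<lambda>r. - (\<kappa> / 2) * r) at_bot at_top"
      using \<kappa>_pos by (intro filterlim_tendsto_neg_mult_at_bot[OF tendsto_const] filterlim_ident) simp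
    then have "((\<lambda>r. C * exp (- (\<kappa> / 2) * r)) \<longlongrightarrow> C * 0) at_top"
      by (intro tendsto_mult_left filterlim_compose[OF exp_at_bot])
    then have "((\<lambda>r. C * exp (- (\<kappa> / 2) * r)) \<longlongrightarrow> 0) at_top"
      by (simp only: mult_zero_right)
    moreover have "\<forall>\<^sub>F r in at_top. norm (exp_powr b (ray v r)) \<le> C * exp (- (\<kappa> / 2) * r)"
      using eventually_ge_at_top[of 0] by eventually_elim (rule C)
    ultimately show "((\<lambda>r. exp_powr b (ray v r)) \<longlongrightarrow> 0) at_top"
      by (rule Lim_null_comparison[rotated])
  qed
  moreover have "exp_powr b (ray v 0) = of_real (exp v * v powr b)"
    using assms by (simp add: exp_powr_def powr_of_real exp_of_real)
  ultimately show ?thesis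
    by simp
qed

end

text \<open>A product majorant reduces joint integrability to one variable at a time. It justifies
  Fubini in \<open>v\<close> and \<open>r\<close> when the ray is moved, and in \<open>s\<close> and
  \<open>r\<close> for the Mellin transform.\<close>

lemma (in pair_sigma_finite) integrable_product_bound:
  fixes f :: "'a \<Rightarrow> 'b \<Rightarrow> 'c::{banach, second_countable_topology}" and g :: "'a \<Rightarrow> real" and h :: "'b \<Rightarrow> real"
  assumes f [measurable]: "case_prod f \<in> borel_measurable (M1 \<Otimes>\<^sub>M M2)"
    and g: "integrable M1 g" and h: "integrable M2 h"
    and bound: "\<And>x y. x \<in> space M1 \<Longrightarrow> y \<in> space M2 \<Longrightarrow> norm (f x y) \<le> g x * h y"
  shows "integrable (M1 \<Otimes>\<^sub>M M2) (case_prod f)"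
proof (rule Fubini_integrable)
  have int: "integrable M2 (f x)" if "x \<in> space M1" for x
  proof (rule Bochner_Integration.integrable_bound)
    show "integrable M2 (\<lambda>y. g x * h y)"
      using h by (rule integrable_mult_right)
    show "f x \<in> borel_measurable M2"
      using measurable_compose[OF measurable_Pair1'[OF that, of M2] f] by simp
    show "AE y in M2. norm (f x y) \<le> norm (g x * h y)"
      using bound[OF that] by (intro AE_I2) (force intro: order_trans[OF _ abs_ge_self])
  qed
  then show "AE x in M1. integrable M2 (\<lambda>y. case (x, y) of (x, y) \<Rightarrow> f x y)"
    by (intro AE_I2) simp
  show "integrable M1 (\<lambda>x. \<integral>y. norm (case (x, y) of (x, y) \<Rightarrow> f x y) \<partial>M2)"
  proof (rule Bochner_Integration.integrable_bound)
    show "integrable M1 (\<lambda>x. g x * integral\<^sup>L M2 h)"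
      using g by (rule integrable_mult_left)
    show "(\<lambda>x. \<integral>y. norm (case (x, y) of (x, y) \<Rightarrow> f x y) \<partial>M2) \<in> borel_measurable M1"
      by measurable
    show "AE x in M1. norm (\<integral>y. norm (case (x, y) of (x, y) \<Rightarrow> f x y) \<partial>M2) \<le> norm (g x * integral\<^sup>L M2 h)"
    proof (rule AE_I2)
      fix x
      assume x: "x \<in> space M1"
      have "(\<integral>y. norm (f x y) \<partial>M2) \<le> (\<integral>y. g x * h y \<partial>M2)"
        using int[OF x] h bound[OF x] by (intro integral_mono) auto
      moreover have "0 \<le> (\<integral>y. norm (f x y) \<partial>M2)"
        by simp
      ultimately show "norm (\<integral>y. norm (case (x, y) of (x, y) \<Rightarrow> f x y) \<partial>M2) \<le> norm (g x * integral\<^sup>L M2 h)"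
        by simp
    qed
  qed
qed simp

lemma cis_powr:
  assumes "- pi < x" "x \<le> pi"
  shows "cis x powr of_real b = cis (b * x)"
  using assms by (simp add: powr_def Ln_cis cis_conv_exp mult_ac)

section \<open>Moving the starting point of the ray to the origin\<close>

context oblique_ray
begin

text \<open>
  The derivative of the ray integral with respect to its starting point \<open>v\<close> is minus the integrand
  at \<open>v\<close>, which is real.
\<close>

lemma Im_integral_exp_powr_shift:
  assumes "1 \<le> b"
  shows "Im (\<integral>r. exp_powr b (ray 1 r) * cis \<theta> \<partial>halfline) = Im (\<integral>r. exp_powr b (ray 0 r) * cis \<theta> \<partial>halfline)"
proof -
  define V where "V = restrict_space lborel {0..1::real}"
  \<comment> \<open>For \<open>r > 0\<close>, \<open>g\<close> is both the
    \<open>v\<close>-derivative of \<open>exp_powr b (ray v r) * cis \<theta>\<close> and the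
    \<open>r\<close>-derivative of \<open>exp_powr b (ray v r)\<close>. One order of integration
    gives the difference of the two ray integrals, the other gives real boundary terms.\<close>
  define g where "g = (\<lambda>v r. (exp_powr b (ray v r) + of_real b * exp_powr (b - 1) (ray v r)) * cis \<theta>)"
  have space_V: "space V = {0..1}"
    by (simp add: V_def space_restrict_space)
  interpret V: sigma_finite_measure V
    unfolding V_def by (rule sigma_finite_measure_restrict_space) (auto simp: sigma_finite_lborel)
  interpret halfline: sigma_finite_measure halfline
    by (rule sigma_finite_halfline)
  interpret pair_sigma_finite V halfline ..
  obtain C where C: "\<And>v r. \<lbrakk>0 \<le> v; v \<le> 1; 0 \<le> r\<rbrakk> \<Longrightarrow> norm (exp_powr b (ray v r)) \<le> C * exp (- (\<kappa> / 2) * r)"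
    using exp_powr_ray_bound_pos[of b] assms by (metis order_trans zero_le_one)
  \<comment> \<open>The exponent \<open>b - 1\<close> is nonnegative by \<open>1 \<le> b\<close>, so
    this bound too is uniform down to \<open>v = 0\<close>.\<close>
  obtain D where D: "\<And>v r. \<lbrakk>0 \<le> v; v \<le> 1; 0 \<le> r\<rbrakk> \<Longrightarrow> norm (exp_powr (b - 1) (ray v r)) \<le> D * exp (- (\<kappa> / 2) * r)"
    using exp_powr_ray_bound_pos[of "b - 1"] assms by (metis diff_ge_0_iff_ge)
  have "integrable (V \<Otimes>\<^sub>M halfline) (case_prod g)"
  proof (rule integrable_product_bound)
    show "case_prod g \<in> borel_measurable (V \<Otimes>\<^sub>M halfline)"
      unfolding g_def V_def split_beta' by measurable
    show "integrable V (\<lambda>v. C + b * D)"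
      unfolding V_def by (simp add: integrable_restrict_space)
    show "integrable halfline (\<lambda>r. exp (- (\<kappa> / 2) * r))"
      using integrable_exp_neg[of "\<kappa> / 2"] \<kappa>_pos by simp
    fix v r :: real
    assume "v \<in> space V" "r \<in> space halfline"
    then have *: "0 \<le> v" "v \<le> 1" "0 \<le> r"
      by (auto simp: space_V)
    have "norm (g v r) \<le> norm (exp_powr b (ray v r)) + b * norm (exp_powr (b - 1) (ray v r))"
      using assms unfolding g_def norm_mult norm_cis mult_1_right
      by (intro order_trans[OF norm_triangle_ineq]) (simp add: norm_mult)
    also have "\<dots> \<le> C * exp (- (\<kappa> / 2) * r) + b * (D * exp (- (\<kappa> / 2) * r))"
      using assms by (intro add_mono mult_left_mono C D *) auto
    finally show "norm (g v r) \<le> (C + b * D) * exp (- (\<kappa> / 2) * r)"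
      by (simp only: distrib_right mult.assoc)
  qed
  then have Fubini: "(\<integral>r. (\<integral>v. g v r \<partial>V) \<partial>halfline) = (\<integral>v. (\<integral>r. g v r \<partial>halfline) \<partial>V)"
    by (rule Fubini_integral)
  have "(\<integral>v. g v r \<partial>V) = exp_powr b (ray 1 r) * cis \<theta> - exp_powr b (ray 0 r) * cis \<theta>" if "0 < r" for r
  proof -
    have "(\<integral>v. g v r \<partial>V) = (\<integral>v. indicator {0..1} v *\<^sub>R g v r \<partial>lborel)"
      unfolding V_def by (subst integral_restrict_space) auto
    also have "\<dots> = exp_powr b (ray 1 r) * cis \<theta> - exp_powr b (ray 0 r) * cis \<theta>"
    proof (rule integral_FTC_Icc)
      fix v :: real
      assume "0 \<le> v" "v \<le> 1"
      have "ray v r \<notin> \<real>\<^sub>\<le>\<^sub>0"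
        using ray_not_nonpos that by auto
      then have "((\<lambda>z. exp_powr b (z + of_real r * cis \<theta>)) has_field_derivative
          (exp_powr b (ray v r) + of_real b * exp_powr (b - 1) (ray v r)) * 1) (at (of_real v))"
        by (intro DERIV_chain2[OF has_field_derivative_exp_powr]) (auto intro!: derivative_eq_intros)
      then have "((\<lambda>z. exp_powr b (z + of_real r * cis \<theta>) * cis \<theta>) has_field_derivative g v r) (at (of_real v))"
        unfolding g_def mult_1_right by (rule DERIV_cmult_right)
      then show "((\<lambda>v. exp_powr b (ray v r) * cis \<theta>) has_vector_derivative g v r) (at v within {0..1})"
        by (rule has_vector_derivative_at_within[OF has_vector_derivative_real_field])
    next
      have "continuous_on {0..1} (\<lambda>v. exp_powr c (ray v r))" for c
        by (intro continuous_at_imp_continuous_on ballI isCont_o2[OF _ isCont_exp_powr] continuous_intros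
            ray_not_nonpos) (use that in auto)
      then show "continuous_on {0..1} (\<lambda>v. g v r)"
        unfolding g_def by (intro continuous_intros)
    qed simp
    finally show ?thesis .
  qed
  then have "(\<integral>r. (\<integral>v. g v r \<partial>V) \<partial>halfline) =
      (\<integral>r. exp_powr b (ray 1 r) * cis \<theta> - exp_powr b (ray 0 r) * cis \<theta> \<partial>halfline)"
    by (intro Bochner_Integration.integral_cong) auto
  also have "\<dots> = (\<integral>r. exp_powr b (ray 1 r) * cis \<theta> \<partial>halfline) - (\<integral>r. exp_powr b (ray 0 r) * cis \<theta> \<partial>halfline)"
    using assms by (intro Bochner_Integration.integral_diff integrable_mult_left integrable_exp_powr_ray) auto
  finally have diff: "(\<integral>r. exp_powr b (ray 1 r) * cis \<theta> \<partial>halfline) - (\<integral>r. exp_powr b (ray 0 r) * cis \<theta> \<partial>halfline)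
      = (\<integral>v. (\<integral>r. g v r \<partial>halfline) \<partial>V)"
    using Fubini by simp
  have "(\<integral>v. (\<integral>r. g v r \<partial>halfline) \<partial>V) = (\<integral>v. of_real (- (exp v * v powr b)) \<partial>V)"
  proof (rule integral_cong_AE)
    \<comment> \<open>The point \<open>v = 0\<close> is discarded because
      \<open>integral_exp_powr_deriv\<close> requires \<open>0 < v\<close>.\<close>
    have "AE v in V. v \<noteq> 0"
      unfolding V_def using AE_lborel_singleton[of 0] by (auto simp: AE_restrict_space_iff)
    then show "AE v in V. (\<integral>r. g v r \<partial>halfline) = of_real (- (exp v * v powr b))"
      using AE_space
    proof eventually_elim
      case (elim v)
      then show ?case
        using integral_exp_powr_deriv[of v b] by (simp add: g_def space_V)
    qed
    have [measurable]: "case_prod g \<in> borel_measurable (V \<Otimes>\<^sub>M halfline)"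
      unfolding g_def V_def split_beta' by measurable
    show "(\<lambda>v. \<integral>r. g v r \<partial>halfline) \<in> borel_measurable V"
      by measurable
    show "(\<lambda>v. complex_of_real (- (exp v * v powr b))) \<in> borel_measurable V"
      unfolding V_def by measurable
  qed
  also have "\<dots> = of_real (\<integral>v. - (exp v * v powr b) \<partial>V)"
    by (rule integral_complex_of_real)
  finally show ?thesis
    using arg_cong[OF diff, of Im] by (simp only: minus_complex.sel Im_complex_of_real)
qed

text \<open>On the ray from the origin this is a Gamma integral with complex rate
  \<open>- cis \<theta>\<close>, whose real part \<open>\<kappa>\<close> is positive. Its imaginary
  part is \<open>Gamma (b + 1) * sin (pi * (b + 1))\<close>, which the reflection formula
  converts.\<close>

lemma Im_integral_exp_powr_0:
  assumes "0 \<le> b"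
  shows "Im (\<integral>r. exp_powr b (ray 0 r) * cis \<theta> \<partial>halfline) = pi * rGamma (- b)"
proof -
  have "0 < Re (- cis \<theta>)"
    using \<kappa>_pos by (simp add: \<kappa>_def)
  then have "has_bochner_integral halfline (\<lambda>r. of_real (r powr (b + 1 - 1)) * exp (- of_real r * (- cis \<theta>)))
      (of_real (Gamma (b + 1)) * (- cis \<theta>) powr (- of_real (b + 1)))"
    using assms by (intro Gamma_rate_complex) auto
  then have "has_bochner_integral halfline (\<lambda>r. cis (b * \<theta>) * cis \<theta> *
        (of_real (r powr (b + 1 - 1)) * exp (- of_real r * (- cis \<theta>))))
      (cis (b * \<theta>) * cis \<theta> * (of_real (Gamma (b + 1)) * (- cis \<theta>) powr (- of_real (b + 1))))"
    by (rule has_bochner_integral_mult_right)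
  moreover have "cis (b * \<theta>) * cis \<theta> * (of_real (r powr (b + 1 - 1)) * exp (- of_real r * (- cis \<theta>))) =
      exp_powr b (ray 0 r) * cis \<theta>" if "0 < r" for r
  proof -
    have "(of_real r * cis \<theta>) powr of_real b = of_real r powr of_real b * cis \<theta> powr of_real b"
      using that by (intro powr_times_real_left) auto
    also have "cis \<theta> powr of_real b = cis (b * \<theta>)"
      using \<theta>_gt \<theta>_less pi_gt_zero by (intro cis_powr) linarith+
    finally show ?thesis
      using that by (simp add: exp_powr_def powr_of_real)
  qed
  ultimately have "has_bochner_integral halfline (\<lambda>r. exp_powr b (ray 0 r) * cis \<theta>)
      (cis (b * \<theta>) * cis \<theta> * (of_real (Gamma (b + 1)) * (- cis \<theta>) powr (- of_real (b + 1))))"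
    by (subst has_bochner_integral_cong[OF refl _ refl, symmetric]) auto
  then have "(\<integral>r. exp_powr b (ray 0 r) * cis \<theta> \<partial>halfline) =
      cis (b * \<theta>) * cis \<theta> * (of_real (Gamma (b + 1)) * (- cis \<theta>) powr (- of_real (b + 1)))"
    by (rule has_bochner_integral_integral_eq)
  \<comment> \<open>The angle \<open>\<theta> - pi\<close> lies in the principal range, so the power
    merely multiplies it.\<close>
  also have "- cis \<theta> = cis (\<theta> - pi)"
    by (simp flip: cis_divide)
  also have "\<dots> powr (- of_real (b + 1)) = cis (- (b + 1) * (\<theta> - pi))"
    using cis_powr[of "\<theta> - pi" "- (b + 1)"] \<theta>_gt \<theta>_less pi_gt_zero by simp
  also have "cis (b * \<theta>) * cis \<theta> * (of_real (Gamma (b + 1)) * cis (- (b + 1) * (\<theta> - pi))) =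
      of_real (Gamma (b + 1)) * (cis (b * \<theta>) * cis \<theta> * cis (- (b + 1) * (\<theta> - pi)))"
    by (simp only: mult_ac)
  \<comment> \<open>The angle \<open>\<theta>\<close> cancels, so the value is the same for every
    admissible ray.\<close>
  also have "cis (b * \<theta>) * cis \<theta> * cis (- (b + 1) * (\<theta> - pi)) = cis (pi * (b + 1))"
    unfolding cis_mult by (rule arg_cong[where f = cis]) (simp add: algebra_simps)
  finally have "Im (\<integral>r. exp_powr b (ray 0 r) * cis \<theta> \<partial>halfline) = Gamma (b + 1) * sin (pi * (b + 1))"
    by simp
  also have "sin (pi * (b + 1)) = pi * (rGamma (b + 1) * rGamma (- b))"
  proof -
    have "complex_of_real (rGamma (b + 1) * rGamma (1 - (b + 1))) = of_real (sin (pi * (b + 1)) / pi)"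
      by (simp only: of_real_mult of_real_divide of_real_diff of_real_1 rGamma_complex_of_real[symmetric]
          sin_of_real[symmetric] rGamma_reflection_complex)
    then show ?thesis
      unfolding of_real_eq_iff by simp
  qed
  also have "Gamma (b + 1) * (pi * (rGamma (b + 1) * rGamma (- b))) = pi * rGamma (- b)"
  proof -
    have "Gamma (b + 1) \<noteq> 0"
      using assms Gamma_real_pos[of "b + 1"] by linarith
    then show ?thesis
      by (simp add: rGamma_inverse_Gamma)
  qed
  finally show ?thesis .
qed

section \<open>Hankel's formula and a bound for the reciprocal gamma function\<close>

lemma norm_exp_powr_ray_le:
  assumes "0 \<le> z" "0 \<le> r"
  shows "norm (exp_powr (- z) (ray 1 r)) \<le> exp 1 * sin \<theta> powr (- z) * exp (- \<kappa> * r)"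
proof -
  \<comment> \<open>The exponent is nonpositive, so the least possible modulus gives the bound. Its
    explicit dependence on \<open>z\<close> is used both for the limit at \<open>1\<close> and for
    the growth of \<open>rGamma\<close>.\<close>
  have "norm (ray 1 r) powr (- z) \<le> sin \<theta> powr (- z)"
    using norm_ray_ge[of 1 r] sin_pos assms by (intro powr_mono2') auto
  then have "exp (1 + - \<kappa> * r) * norm (ray 1 r) powr (- z) \<le> exp (1 + - \<kappa> * r) * sin \<theta> powr (- z)"
    by (rule mult_left_mono) simp
  moreover have "Re (ray 1 r) = 1 + - \<kappa> * r"
    by (simp add: \<kappa>_def)
  ultimately have "exp (Re (ray 1 r)) * norm (ray 1 r) powr (- z) \<le> exp (1 + - \<kappa> * r) * sin \<theta> powr (- z)"
    by (simp only:)
  then show ?thesis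
    unfolding norm_exp_powr by (simp only: exp_add mult_ac)
qed

text \<open>This is the upper half of Hankel's contour. The lower half contributes minus the complex
  conjugate, so the factor \<open>1 / (2 * pi * \<i>)\<close> leaves
  \<open>Im (hankel z) / pi\<close>.\<close>

definition hankel :: "real \<Rightarrow> complex" where
  "hankel z = (\<integral>r. exp_powr (- z) (ray 1 r) * cis \<theta> \<partial>halfline)"

text \<open>Integration by parts gives the functional equation of \<open>rGamma\<close> up to a real
  boundary term.\<close>

lemma Im_hankel_plus1: "Im (hankel z) = z * Im (hankel (z + 1))"
proof -
  have int: "integrable halfline (\<lambda>r. exp_powr b (ray 1 r) * cis \<theta>)" for b
    by (intro integrable_mult_left integrable_exp_powr_ray) auto
  have "- z - 1 = - (z + 1)"
    by simp
  then have "(\<integral>r. (exp_powr (- z) (ray 1 r) + of_real (- z) * exp_powr (- z - 1) (ray 1 r)) * cis \<theta> \<partial>halfline) =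
      (\<integral>r. exp_powr (- z) (ray 1 r) * cis \<theta> + of_real (- z) * (exp_powr (- (z + 1)) (ray 1 r) * cis \<theta>) \<partial>halfline)"
    by (simp only: distrib_right mult.assoc)
  also have "\<dots> = hankel z + of_real (- z) * hankel (z + 1)"
    unfolding hankel_def
    by (subst Bochner_Integration.integral_add[OF int integrable_mult_right[OF int]])
       (simp only: integral_mult_right_zero)
  finally have "hankel z + of_real (- z) * hankel (z + 1) = - of_real (exp 1 * 1 powr (- z))"
    using integral_exp_powr_deriv[of 1 "- z"] by simp
  from arg_cong[OF this, of Im] show ?thesis
    by simp
qed

lemma Im_hankel_le_minus_1: "z \<le> - 1 \<Longrightarrow> Im (hankel z) = pi * rGamma z"
  unfolding hankel_def using Im_integral_exp_powr_shift[of "- z"] Im_integral_exp_powr_0[of "- z"] by simp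

text \<open>Both sides obey the same recurrence; passing from \<open>z - 1\<close> to
  \<open>z\<close> divides by \<open>z - 1\<close>.\<close>

lemma Im_hankel_step:
  assumes "Im (hankel (z - 1)) = pi * rGamma (z - 1)" "z \<noteq> 1"
  shows "Im (hankel z) = pi * rGamma z"
proof -
  have "(z - 1) * Im (hankel z) = (z - 1) * (pi * rGamma z)"
    using Im_hankel_plus1[of "z - 1"] rGamma_plus1[of "z - 1"] assms(1)
    by (metis diff_add_cancel mult.left_commute)
  then show ?thesis
    using assms(2) by simp
qed

text \<open>The recurrence cannot cross \<open>z = 1\<close>, where it degenerates to \<open>0 = 0\<close>.\<close>

lemma Im_hankel_1: "Im (hankel 1) = pi * rGamma 1"
proof (rule LIMSEQ_unique)
  define u where "u = (\<lambda>n. 1 - 1 / real (Suc n))"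
  have u: "0 \<le> u n" "u n < 1" for n
    by (auto simp: u_def field_simps)
  have "u \<longlonglongrightarrow> 1 - 0"
    unfolding u_def by (intro tendsto_diff tendsto_const lim_1_over_n[THEN LIMSEQ_Suc])
  then have lim: "u \<longlonglongrightarrow> 1"
    by simp
  have "(\<lambda>n. hankel (u n)) \<longlonglongrightarrow> hankel 1"
    unfolding hankel_def
  proof (rule integral_dominated_convergence)
    show "integrable halfline (\<lambda>r. exp 1 * sin \<theta> powr (- 1) * exp (- \<kappa> * r))"
      using \<kappa>_pos by (intro integrable_mult_right integrable_exp_neg)
    show "AE r in halfline. (\<lambda>n. exp_powr (- u n) (ray 1 r) * cis \<theta>) \<longlonglongrightarrow> exp_powr (- 1) (ray 1 r) * cis \<theta>"
    proof (rule AE_I2)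
      fix r :: real
      assume "r \<in> space halfline"
      then have "ray 1 r \<noteq> 0"
        using ray_not_nonpos[of 1 r] by auto
      then show "(\<lambda>n. exp_powr (- u n) (ray 1 r) * cis \<theta>) \<longlonglongrightarrow> exp_powr (- 1) (ray 1 r) * cis \<theta>"
        unfolding exp_powr_def powr_def
        by (simp only: if_False) (intro tendsto_intros lim)
    qed
    fix n
    show "AE r in halfline. norm (exp_powr (- u n) (ray 1 r) * cis \<theta>) \<le> exp 1 * sin \<theta> powr (- 1) * exp (- \<kappa> * r)"
    proof (rule AE_I2)
      fix r :: real
      assume "r \<in> space halfline"
      then have "norm (exp_powr (- u n) (ray 1 r)) \<le> exp 1 * sin \<theta> powr (- u n) * exp (- \<kappa> * r)"
        using u[of n] by (intro norm_exp_powr_ray_le) auto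
      \<comment> \<open>As \<open>sin \<theta> \<le> 1\<close> and \<open>u n < 1\<close>, the
        exponent may be lowered to \<open>- 1\<close>, which makes the majorant independent of
        \<open>n\<close>.\<close>
      also have "\<dots> \<le> exp 1 * sin \<theta> powr (- 1) * exp (- \<kappa> * r)"
        using u[of n] sin_pos sin_le_one[of \<theta>] by (intro mult_right_mono mult_left_mono powr_mono') auto
      finally show "norm (exp_powr (- u n) (ray 1 r) * cis \<theta>) \<le> exp 1 * sin \<theta> powr (- 1) * exp (- \<kappa> * r)"
        by (simp add: norm_mult)
    qed
  qed measurable
  then show "(\<lambda>n. Im (hankel (u n))) \<longlonglongrightarrow> Im (hankel 1)"
    by (rule tendsto_Im)
  \<comment> \<open>As \<open>0 \<le> u n < 1\<close>, two recurrence steps lead from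
    \<open>u n - 2 \<le> - 1\<close> up to \<open>u n\<close> without meeting the point
    \<open>1\<close>.\<close>
  have "Im (hankel (u n)) = pi * rGamma (u n)" for n
    using u[of n] by (intro Im_hankel_step[of "u n"] Im_hankel_step[of "u n - 1"] Im_hankel_le_minus_1) auto
  moreover have "(\<lambda>n. pi * rGamma (u n)) \<longlonglongrightarrow> pi * rGamma 1"
    by (intro tendsto_mult_left isCont_tendsto_compose[OF isCont_rGamma lim] continuous_ident)
  ultimately show "(\<lambda>n. Im (hankel (u n))) \<longlonglongrightarrow> pi * rGamma 1"
    by simp
qed

text \<open>The formula spreads from \<open>z \<le> - 1\<close> to the right in unit steps, with
  \<open>z = 1\<close> supplied by the limit argument.\<close>

lemma rGamma_hankel: "rGamma z = Im (hankel z) / pi"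
proof -
  have "z \<le> real k - 1 \<Longrightarrow> Im (hankel z) = pi * rGamma z" for k
  proof (induction k arbitrary: z)
    case 0
    then show ?case by (simp add: Im_hankel_le_minus_1)
  next
    case (Suc k)
    then show ?case
      using Im_hankel_1 Im_hankel_step[of z] by (cases "z = 1") auto
  qed
  from this[of "nat \<lceil>z\<rceil> + 1"] show ?thesis
    by (simp add: real_nat_ceiling_ge)
qed

text \<open>Geometric growth in \<open>z\<close> is a crude bound, but the factorials in the Wright
  series beat it.\<close>

lemma abs_rGamma_le:
  assumes "0 \<le> z"
  shows "\<bar>rGamma z\<bar> \<le> exp 1 / (pi * \<kappa>) * sin \<theta> powr (- z)"
proof -
  have int_exp: "(\<integral>r. exp (- \<kappa> * r) \<partial>halfline) = 1 / \<kappa>"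
  proof -
    have "(\<integral>r. r powr (1 - 1) * exp (- \<kappa> * r) \<partial>halfline) = 1 / \<kappa>"
      using has_bochner_integral_integral_eq[OF Gamma_rate_real[of 1 \<kappa>]] \<kappa>_pos by (simp add: powr_minus_divide)
    also have "(\<integral>r. r powr (1 - 1) * exp (- \<kappa> * r) \<partial>halfline) = (\<integral>r. exp (- \<kappa> * r) \<partial>halfline)"
      by (intro Bochner_Integration.integral_cong) auto
    finally show ?thesis .
  qed
  have "\<bar>Im (hankel z)\<bar> \<le> norm (hankel z)"
    by (rule abs_Im_le_cmod)
  also have "\<dots> \<le> (\<integral>r. exp 1 * sin \<theta> powr (- z) * exp (- \<kappa> * r) \<partial>halfline)"
    unfolding hankel_def
  proof (rule Bochner_Integration.integral_norm_bound_integral)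
    show "integrable halfline (\<lambda>r. exp_powr (- z) (ray 1 r) * cis \<theta>)"
      by (intro integrable_mult_left integrable_exp_powr_ray) auto
    show "integrable halfline (\<lambda>r. exp 1 * sin \<theta> powr (- z) * exp (- \<kappa> * r))"
      using \<kappa>_pos by (intro integrable_mult_right integrable_exp_neg)
    show "norm (exp_powr (- z) (ray 1 r) * cis \<theta>) \<le> exp 1 * sin \<theta> powr (- z) * exp (- \<kappa> * r)"
      if "r \<in> space halfline" for r
      using norm_exp_powr_ray_le[OF assms, of r] that by (simp add: norm_mult)
  qed
  also have "\<dots> = exp 1 * sin \<theta> powr (- z) * (1 / \<kappa>)"
    by (simp only: integral_mult_right_zero int_exp)
  finally have "\<bar>Im (hankel z)\<bar> / pi \<le> exp 1 * sin \<theta> powr (- z) * (1 / \<kappa>) / pi"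
    by (rule divide_right_mono) simp
  then show ?thesis
    by (simp add: rGamma_hankel mult_ac)
qed

end

section \<open>The reduced Wright function\<close>

locale wright_ray = oblique_ray +
  fixes \<sigma> :: real
  assumes \<sigma>_pos: "0 < \<sigma>" and \<sigma>_less: "\<sigma> < 1" and \<sigma>\<theta>_less: "\<sigma> * \<theta> < pi / 2"
begin

definition p :: "real \<Rightarrow> complex" where
  "p r = ray 1 r powr of_real \<sigma>"

lemma borel_measurable_p [measurable]: "p \<in> borel_measurable borel"
  unfolding p_def by measurable

text \<open>The point \<open>1 + r * cis \<theta>\<close> lies in the sector spanned by the
  directions \<open>0\<close> and \<open>\<theta>\<close>. With a larger argument, turning it by
  \<open>- \<theta>\<close> would put it above the real axis, but its imaginary part becomes
  \<open>- sin \<theta>\<close>.\<close>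

lemma Im_Ln_ray:
  assumes "0 \<le> r"
  shows "0 \<le> Im (Ln (ray 1 r))" "Im (Ln (ray 1 r)) \<le> \<theta>"
proof -
  let ?w = "ray 1 r" and ?\<phi> = "Im (Ln (ray 1 r))"
  have nz: "?w \<noteq> 0"
    using ray_not_nonpos[of 1 r] assms by auto
  have "0 \<le> Im ?w"
    using assms sin_pos by simp
  then show "0 \<le> ?\<phi>"
    using Im_Ln_pos_le[OF nz] by blast
  have "?\<phi> \<le> pi"
    by (rule Im_Ln_le_pi[OF nz])
  have polar: "?w = of_real (norm ?w) * cis ?\<phi>"
    using rcis_cmod_Arg[of ?w] Arg_eq_Im_Ln[OF nz] by (simp add: rcis_def)
  show "?\<phi> \<le> \<theta>"
  proof (rule ccontr)
    assume "\<not> ?\<phi> \<le> \<theta>"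
    then have "0 < sin (?\<phi> - \<theta>)"
      using \<open>?\<phi> \<le> pi\<close> \<theta>_gt \<theta>_less pi_gt_zero by (intro sin_gt_zero) linarith+
    then have "0 < norm ?w * sin (?\<phi> - \<theta>)"
      using nz by simp
    also have "norm ?w * sin (?\<phi> - \<theta>) = Im (?w * cis (- \<theta>))"
      by (subst (2) polar) (simp add: mult.assoc cis_mult)
    also have "?w * cis (- \<theta>) = cis (- \<theta>) + of_real r"
      by (simp add: distrib_right mult.assoc cis_mult)
    also have "Im (cis (- \<theta>) + of_real r) = - sin \<theta>"
      by simp
    finally show False
      using sin_pos by simp
  qed
qed

text \<open>The two factors bound from below the modulus of \<open>p r\<close> and the cosine of its
  argument, which lies between \<open>0\<close> and \<open>\<sigma> * \<theta>\<close>.\<close>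

definition \<delta> :: real where "\<delta> = sin \<theta> powr \<sigma> * cos (\<sigma> * \<theta>)"

lemma cos_\<sigma>\<theta>_pos: "0 < cos (\<sigma> * \<theta>)"
proof (rule cos_gt_zero_pi)
  have "0 < \<sigma> * \<theta>"
    using \<sigma>_pos \<theta>_gt pi_gt_zero by (intro mult_pos_pos) linarith+
  then show "- (pi / 2) < \<sigma> * \<theta>"
    using pi_gt_zero by linarith
qed (rule \<sigma>\<theta>_less)

lemma \<delta>_pos: "0 < \<delta>"
  using sin_pos cos_\<sigma>\<theta>_pos by (simp add: \<delta>_def)

lemma norm_p: "norm (p r) = norm (ray 1 r) powr \<sigma>"
  by (simp add: p_def norm_powr_real_powr')

lemma norm_p_le: "0 \<le> r \<Longrightarrow> norm (p r) \<le> (1 + r) powr \<sigma>"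
  unfolding norm_p using norm_ray_le[of 1 r] \<sigma>_pos by (intro powr_mono2) auto

lemma p_eq_exp: "0 \<le> r \<Longrightarrow> p r = exp (of_real \<sigma> * Ln (ray 1 r))"
  using ray_not_nonpos[of 1 r] by (auto simp: p_def powr_def)

lemma Re_p_ge:
  assumes "0 \<le> r"
  shows "\<delta> \<le> Re (p r)"
proof -
  let ?\<phi> = "Im (Ln (ray 1 r))"
  have "\<sigma> * \<theta> \<le> pi"
    using \<sigma>\<theta>_less pi_gt_zero by linarith
  then have "cos (\<sigma> * \<theta>) \<le> cos (\<sigma> * ?\<phi>)"
    using Im_Ln_ray[OF assms] \<sigma>_pos
    by (intro cos_monotone_0_pi_le mult_left_mono mult_nonneg_nonneg) auto
  moreover have "sin \<theta> powr \<sigma> \<le> norm (p r)"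
    unfolding norm_p using norm_ray_ge[of 1 r] sin_pos \<sigma>_pos by (intro powr_mono2) auto
  ultimately have "\<delta> \<le> norm (p r) * cos (\<sigma> * ?\<phi>)"
    unfolding \<delta>_def using cos_\<sigma>\<theta>_pos by (intro mult_mono) auto
  also have "\<dots> = Re (p r)"
    using p_eq_exp[OF assms] by (simp add: Re_exp)
  finally show ?thesis .
qed

text \<open>The argument of \<open>p r\<close> stays below \<open>pi / 2\<close>, so
  \<open>Ln (p r)\<close> is \<open>\<sigma> * Ln (ray 1 r)\<close> without a jump of
  branch.\<close>

lemma p_powr:
  assumes "0 \<le> r"
  shows "p r powr of_real b = ray 1 r powr of_real (\<sigma> * b)"
proof -
  have nz: "ray 1 r \<noteq> 0"
    using ray_not_nonpos[of 1 r] assms by auto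
  have "\<sigma> * Im (Ln (ray 1 r)) \<le> \<sigma> * \<theta>"
    using Im_Ln_ray[OF assms] \<sigma>_pos by (intro mult_left_mono) auto
  moreover have "0 \<le> \<sigma> * Im (Ln (ray 1 r))"
    using Im_Ln_ray[OF assms] \<sigma>_pos by simp
  ultimately have "Ln (p r) = of_real \<sigma> * Ln (ray 1 r)"
    unfolding p_eq_exp[OF assms] using \<sigma>\<theta>_less pi_gt_zero by (intro Ln_exp) auto
  then show ?thesis
    using nz by (simp add: powr_def p_eq_exp[OF assms] mult_ac)
qed

lemma p_power:
  assumes "0 \<le> r"
  shows "p r ^ n = ray 1 r powr of_real (\<sigma> * real n)"
proof -
  have "p r \<noteq> 0"
    using p_eq_exp[OF assms] by simp
  then show ?thesis
    using p_powr[OF assms, of "real n"] by simp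
qed

section \<open>Integral representation and exponential decay\<close>

definition kernel :: "real \<Rightarrow> real \<Rightarrow> complex" where
  "kernel s r = exp (ray 1 r) * exp (- of_real s * p r) * cis \<theta>"

text \<open>Hankel's formula at \<open>- \<sigma> * n\<close> is summed with weights
  \<open>(- s) ^ n / fact n\<close>; under the integral the sum becomes an exponential series in
  \<open>p r\<close>. Convergence is dominated because \<open>norm (p r)\<close> grows sublinearly
  while \<open>exp (ray 1 r)\<close> decays exponentially.\<close>

lemma wright0_sums_kernel:
  "(\<lambda>n. (- s) ^ n * rGamma (- \<sigma> * real n) / fact n) sums (Im (\<integral>r. kernel s r \<partial>halfline) / pi)"
proof -
  define S where "S = (\<lambda>N r. \<Sum>n<N. of_real ((- s) ^ n / fact n) * (exp_powr (- (- \<sigma> * real n)) (ray 1 r) * cis \<theta>))"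
  obtain C where C: "\<And>r. 0 \<le> r \<Longrightarrow> exp (\<bar>s\<bar> * (1 + r) powr \<sigma>) \<le> C * exp (\<kappa> / 2 * r)"
    using exp_powr_bound[of \<sigma> "\<kappa> / 2" "\<bar>s\<bar>"] \<sigma>_pos \<sigma>_less \<kappa>_pos by auto
  have S_eq: "S N r = (\<Sum>n<N. (- of_real s * p r) ^ n /\<^sub>R fact n) * (exp (ray 1 r) * cis \<theta>)" if "0 \<le> r" for N r
  proof -
    have "of_real ((- s) ^ n / fact n) * (exp_powr (- (- \<sigma> * real n)) (ray 1 r) * cis \<theta>) =
      ((- of_real s * p r) ^ n /\<^sub>R fact n) * (exp (ray 1 r) * cis \<theta>)" for n
    proof -
      have "exp_powr (- (- \<sigma> * real n)) (ray 1 r) = exp (ray 1 r) * p r ^ n"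
        unfolding exp_powr_def p_power[OF that] by simp
      moreover have "(- of_real s * p r) ^ n = of_real ((- s) ^ n) * p r ^ n"
        by (simp only: power_mult_distrib of_real_power of_real_minus)
      ultimately show ?thesis
        by (simp only: scaleR_conv_of_real of_real_mult of_real_inverse divide_inverse mult_ac)
    qed
    then show ?thesis
      unfolding S_def sum_distrib_right by (intro sum.cong) auto
  qed
  have "(\<lambda>N. \<integral>r. S N r \<partial>halfline) \<longlonglongrightarrow> (\<integral>r. kernel s r \<partial>halfline)"
  proof (rule integral_dominated_convergence)
    show "integrable halfline (\<lambda>r. (exp 1 * C) * exp (- (\<kappa> / 2) * r))"
      using integrable_exp_neg[of "\<kappa> / 2"] \<kappa>_pos by (intro integrable_mult_right) auto
    show "(\<lambda>r. kernel s r) \<in> borel_measurable halfline"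
      unfolding kernel_def by measurable
    show "S N \<in> borel_measurable halfline" for N
      unfolding S_def by measurable
    show "AE r in halfline. (\<lambda>N. S N r) \<longlonglongrightarrow> kernel s r"
    proof (rule AE_I2)
      fix r :: real
      assume "r \<in> space halfline"
      then have r: "0 \<le> r" by simp
      have "(\<lambda>N. \<Sum>n<N. (- of_real s * p r) ^ n /\<^sub>R fact n) \<longlonglongrightarrow> exp (- of_real s * p r)"
        using exp_converges[of "- of_real s * p r"] by (simp only: sums_def)
      then have "(\<lambda>N. S N r) \<longlonglongrightarrow> exp (- of_real s * p r) * (exp (ray 1 r) * cis \<theta>)"
        unfolding S_eq[OF r] by (rule tendsto_mult_right)
      then show "(\<lambda>N. S N r) \<longlonglongrightarrow> kernel s r"
        by (simp only: kernel_def mult_ac)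
    qed
    fix N
    show "AE r in halfline. norm (S N r) \<le> (exp 1 * C) * exp (- (\<kappa> / 2) * r)"
    proof (rule AE_I2)
      fix r :: real
      assume "r \<in> space halfline"
      then have r: "0 \<le> r" by simp
      \<comment> \<open>The series of moduli bounds all partial sums at once, independently of
        \<open>N\<close>.\<close>
      have "norm (\<Sum>n<N. (- of_real s * p r) ^ n /\<^sub>R fact n) \<le> (\<Sum>n<N. (\<bar>s\<bar> * norm (p r)) ^ n /\<^sub>R fact n)"
        by (rule order_trans[OF norm_sum]) (simp add: norm_mult norm_power)
      also have "\<dots> \<le> exp (\<bar>s\<bar> * norm (p r))"
        unfolding exp_def by (intro sum_le_suminf summable_exp_generic) auto
      also have "\<dots> \<le> exp (\<bar>s\<bar> * (1 + r) powr \<sigma>)"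
        using norm_p_le[OF r] by (simp add: mult_left_mono)
      also note C[OF r]
      finally have "norm (S N r) \<le> C * exp (\<kappa> / 2 * r) * exp (1 - \<kappa> * r)"
        unfolding S_eq[OF r] norm_mult norm_cis norm_exp_eq_Re Re_ray mult_1_right
        by (rule mult_right_mono) simp
      also have "\<dots> = exp 1 * C * exp (- (\<kappa> / 2) * r)"
        by (simp add: mult_ac flip: exp_add)
      finally show "norm (S N r) \<le> exp 1 * C * exp (- (\<kappa> / 2) * r)" .
    qed
  qed
  moreover have "(\<integral>r. S N r \<partial>halfline) = (\<Sum>n<N. of_real ((- s) ^ n / fact n) * hankel (- \<sigma> * real n))" for N
  proof -
    have "0 \<le> - (- \<sigma> * real n)" for n
      using \<sigma>_pos by simp
    then have "integrable halfline (\<lambda>r. exp_powr (- (- \<sigma> * real n)) (ray 1 r) * cis \<theta>)" for n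
      by (intro integrable_mult_left integrable_exp_powr_ray) auto
    then show ?thesis
      unfolding S_def hankel_def
      by (subst Bochner_Integration.integral_sum) (simp_all only: integral_mult_right_zero integrable_mult_right)
  qed
  ultimately have "(\<lambda>n. of_real ((- s) ^ n / fact n) * hankel (- \<sigma> * real n)) sums (\<integral>r. kernel s r \<partial>halfline)"
    by (simp only: sums_def)
  then have "(\<lambda>n. Im (of_real ((- s) ^ n / fact n) * hankel (- \<sigma> * real n)) / pi) sums (Im (\<integral>r. kernel s r \<partial>halfline) / pi)"
    by (intro sums_divide sums_Im)
  moreover have "Im (of_real ((- s) ^ n / fact n) * hankel (- \<sigma> * real n)) / pi = (- s) ^ n * rGamma (- \<sigma> * real n) / fact n" for n
  proof -
    have "Im (of_real x * w) = x * Im w" for x w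
      by simp
    then show ?thesis
      unfolding rGamma_hankel by (simp only: times_divide_eq_left times_divide_eq_right divide_divide_eq_left mult.commute[of pi])
  qed
  ultimately show ?thesis
    by (simp only:)
qed

lemma wright0_kernel: "wright0 (- \<sigma>) (- s) = Im (\<integral>r. kernel s r \<partial>halfline) / pi"
proof -
  \<comment> \<open>The series for \<open>wright0\<close> starts at index one; the extra term at
    zero vanishes since \<open>rGamma 0 = 0\<close>.\<close>
  have "(\<lambda>n. (- s) ^ Suc n * rGamma (- \<sigma> * real (Suc n)) / fact (Suc n)) sums
      (Im (\<integral>r. kernel s r \<partial>halfline) / pi - (- s) ^ 0 * rGamma (- \<sigma> * real 0) / fact 0)"
    using wright0_sums_kernel[of s] by (subst sums_Suc_iff) simp
  then show ?thesis
    unfolding wright0_def by (simp add: sums_iff)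
qed

lemma norm_kernel_le:
  assumes "0 \<le> s" "0 \<le> r"
  shows "norm (kernel s r) \<le> exp (- \<delta> * s) * exp (1 - \<kappa> * r)"
proof -
  have "s * \<delta> \<le> s * Re (p r)"
    using Re_p_ge[OF assms(2)] assms by (intro mult_left_mono) auto
  then have "norm (exp (- of_real s * p r)) \<le> exp (- \<delta> * s)"
    by (simp add: norm_exp_eq_Re mult.commute)
  then show ?thesis
    unfolding kernel_def norm_mult norm_cis norm_exp_eq_Re Re_ray mult_1_right
    by (subst mult.commute) (rule mult_right_mono, simp_all)
qed

lemma integrable_exp_ray: "integrable halfline (\<lambda>r. exp (1 - \<kappa> * r))"
proof -
  have "integrable halfline (\<lambda>r. exp 1 * exp (- \<kappa> * r))"
    using \<kappa>_pos by (intro integrable_mult_right integrable_exp_neg)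
  then show ?thesis
    by (simp flip: exp_add)
qed

definition K :: real where "K = (\<integral>r. exp (1 - \<kappa> * r) \<partial>halfline) / pi"

lemma integrable_kernel:
  assumes "0 \<le> s"
  shows "integrable halfline (kernel s)"
proof (rule Bochner_Integration.integrable_bound)
  show "integrable halfline (\<lambda>r. exp (- \<delta> * s) * exp (1 - \<kappa> * r))"
    by (intro integrable_mult_right integrable_exp_ray)
  show "kernel s \<in> borel_measurable halfline"
    unfolding kernel_def[abs_def] by measurable
  show "AE r in halfline. norm (kernel s r) \<le> norm (exp (- \<delta> * s) * exp (1 - \<kappa> * r))"
    using norm_kernel_le[OF assms] by (intro AE_I2) (simp add: abs_mult)
qed

text \<open>The decay comes from cancellation in the alternating powers of \<open>- s\<close> and is
  invisible termwise; the kernel shows it through \<open>Re (p r) \<ge> \<delta>\<close>.\<close>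

lemma abs_wright0_le:
  assumes "0 \<le> s"
  shows "\<bar>wright0 (- \<sigma>) (- s)\<bar> \<le> K * exp (- \<delta> * s)"
proof -
  have "\<bar>Im (\<integral>r. kernel s r \<partial>halfline)\<bar> \<le> norm (\<integral>r. kernel s r \<partial>halfline)"
    by (rule abs_Im_le_cmod)
  also have "\<dots> \<le> (\<integral>r. exp (- \<delta> * s) * exp (1 - \<kappa> * r) \<partial>halfline)"
    using integrable_kernel[OF assms] norm_kernel_le[OF assms]
    by (intro Bochner_Integration.integral_norm_bound_integral integrable_mult_right integrable_exp_ray) auto
  also have "\<dots> = exp (- \<delta> * s) * (\<integral>r. exp (1 - \<kappa> * r) \<partial>halfline)"
    by (rule integral_mult_right_zero)
  finally have "\<bar>Im (\<integral>r. kernel s r \<partial>halfline)\<bar> / pi \<le> exp (- \<delta> * s) * (\<integral>r. exp (1 - \<kappa> * r) \<partial>halfline) / pi"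
    by (rule divide_right_mono) simp
  then show ?thesis
    by (simp add: wright0_kernel K_def mult_ac)
qed

section \<open>Mellin transform and termwise integration\<close>

lemma borel_measurable_wright0 [measurable]: "wright0 b \<in> borel_measurable borel"
  unfolding wright0_def[abs_def] by measurable

text \<open>After interchanging the integrals, the one over \<open>s\<close> is a Gamma integral
  with rate \<open>p r\<close>. It leaves the power \<open>- (\<sigma> * a)\<close> of
  \<open>ray 1 r\<close>, and the one over \<open>r\<close> is then Hankel's at
  \<open>\<sigma> * a\<close>.\<close>

lemma Mellin_wright0:
  assumes "0 < a"
  shows "has_bochner_integral halfline (\<lambda>s. s powr (a - 1) * wright0 (- \<sigma>) (- s)) (Gamma a * rGamma (\<sigma> * a))"
proof -
  define f where "f = (\<lambda>s r. of_real (s powr (a - 1)) * kernel s r)"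
  interpret halfline: sigma_finite_measure halfline
    by (rule sigma_finite_halfline)
  interpret pair_sigma_finite halfline halfline ..
  have int: "integrable (halfline \<Otimes>\<^sub>M halfline) (case_prod f)"
  proof (rule integrable_product_bound)
    show "case_prod f \<in> borel_measurable (halfline \<Otimes>\<^sub>M halfline)"
      unfolding f_def kernel_def split_beta' by measurable
    show "integrable halfline (\<lambda>s. s powr (a - 1) * exp (- \<delta> * s))"
      using Gamma_rate_real[OF assms \<delta>_pos] by (simp only: has_bochner_integral_iff)
    show "integrable halfline (\<lambda>r. exp (1 - \<kappa> * r))"
      by (rule integrable_exp_ray)
    fix s r
    assume "s \<in> space halfline" "r \<in> space halfline"
    then have "norm (kernel s r) \<le> exp (- \<delta> * s) * exp (1 - \<kappa> * r)"
      by (intro norm_kernel_le) auto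
    then show "norm (f s r) \<le> s powr (a - 1) * exp (- \<delta> * s) * exp (1 - \<kappa> * r)"
      by (simp add: f_def norm_mult mult.assoc mult_left_mono)
  qed
  have int': "integrable halfline (\<lambda>s. \<integral>r. f s r \<partial>halfline)"
    using integrable_fst[OF int] by simp
  have "(\<integral>s. (\<integral>r. f s r \<partial>halfline) \<partial>halfline) = (\<integral>r. (\<integral>s. f s r \<partial>halfline) \<partial>halfline)"
    using Fubini_integral[OF int] by simp
  also have "\<dots> = (\<integral>r. of_real (Gamma a) * (exp_powr (- (\<sigma> * a)) (ray 1 r) * cis \<theta>) \<partial>halfline)"
  proof (rule Bochner_Integration.integral_cong)
    fix r
    assume "r \<in> space halfline"
    then have r: "0 \<le> r" by simp
    have "0 < Re (p r)"
      using Re_p_ge[OF r] \<delta>_pos by simp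
    from has_bochner_integral_integral_eq[OF Gamma_rate_complex[OF assms this]]
    have "(\<integral>s. exp (ray 1 r) * cis \<theta> * (of_real (s powr (a - 1)) * exp (- of_real s * p r)) \<partial>halfline) =
        exp (ray 1 r) * cis \<theta> * (of_real (Gamma a) * p r powr (- of_real a))"
      by (simp only: integral_mult_right_zero)
    moreover have "p r powr (- of_real a) = ray 1 r powr of_real (- (\<sigma> * a))"
      using p_powr[OF r, of "- a"] by simp
    moreover have "f s r = exp (ray 1 r) * cis \<theta> * (of_real (s powr (a - 1)) * exp (- of_real s * p r))" for s
      by (simp only: f_def kernel_def mult_ac)
    ultimately show "(\<integral>s. f s r \<partial>halfline) = of_real (Gamma a) * (exp_powr (- (\<sigma> * a)) (ray 1 r) * cis \<theta>)"
      by (simp only: exp_powr_def mult_ac)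
  qed simp
  also have "\<dots> = of_real (Gamma a) * hankel (\<sigma> * a)"
    unfolding hankel_def by (rule integral_mult_right_zero)
  finally have "has_bochner_integral halfline (\<lambda>s. \<integral>r. f s r \<partial>halfline) (of_real (Gamma a) * hankel (\<sigma> * a))"
    using int' by (simp add: has_bochner_integral_iff)
  then have "has_bochner_integral halfline (\<lambda>s. Im (\<integral>r. f s r \<partial>halfline) / pi) (Im (of_real (Gamma a) * hankel (\<sigma> * a)) / pi)"
    by (intro has_bochner_integral_divide_zero has_bochner_integral_Im)
  moreover have "Im (\<integral>r. f s r \<partial>halfline) / pi = s powr (a - 1) * wright0 (- \<sigma>) (- s)" for s
    by (simp add: f_def wright0_kernel)
  moreover have "Im (of_real (Gamma a) * hankel (\<sigma> * a)) / pi = Gamma a * rGamma (\<sigma> * a)"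
    by (simp add: rGamma_hankel)
  ultimately show ?thesis
    by (simp only:)
qed

lemma wright0_subordination:
  fixes \<rho> y :: real
  assumes "0 < \<rho>"
  shows "has_bochner_integral halfline (\<lambda>s. wright0 (- \<sigma>) (- s) * wright0 \<rho> (y * s powr \<rho>) / s)
           (wright0 (\<rho> * \<sigma>) y)"
proof -
  define c where "c = (\<lambda>n. y ^ Suc n * rGamma (\<rho> * real (Suc n)) / fact (Suc n))"
  define T where "T = (\<lambda>n s. c n * (s powr (\<rho> * real (Suc n) - 1) * wright0 (- \<sigma>) (- s)))"
  have a_pos: "0 < \<rho> * real (Suc n)" for n
    using assms by simp
  have "has_bochner_integral halfline (T n)
      (c n * (Gamma (\<rho> * real (Suc n)) * rGamma (\<sigma> * (\<rho> * real (Suc n)))))" for n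
    unfolding T_def by (intro has_bochner_integral_mult_right Mellin_wright0 a_pos)
  \<comment> \<open>The Mellin transform supplies exactly the Gamma factor that cancels the
    reciprocal one in \<open>c n\<close>.\<close>
  moreover have rGamma_Gamma: "rGamma (\<rho> * real (Suc n)) * Gamma (\<rho> * real (Suc n)) = 1" for n
  proof -
    have "Gamma (\<rho> * real (Suc n)) \<noteq> 0"
      using Gamma_real_pos[OF a_pos[of n]] by linarith
    then show ?thesis
      by (simp add: rGamma_inverse_Gamma)
  qed
  moreover have "c n * (Gamma (\<rho> * real (Suc n)) * rGamma (\<sigma> * (\<rho> * real (Suc n)))) =
      (rGamma (\<rho> * real (Suc n)) * Gamma (\<rho> * real (Suc n))) *
      (y ^ Suc n * rGamma (\<rho> * \<sigma> * real (Suc n)) / fact (Suc n))" for n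
    unfolding c_def by (simp only: divide_inverse mult_ac)
  ultimately have T_int: "has_bochner_integral halfline (T n) (y ^ Suc n * rGamma (\<rho> * \<sigma> * real (Suc n)) / fact (Suc n))" for n
    by (simp only: mult_1)
  then have integrable_T: "integrable halfline (T n)" for n
    by (simp only: has_bochner_integral_iff)
  have summable_exp_Suc: "summable (\<lambda>n. M * (z ^ Suc n / fact (Suc n)))" for M z :: real
    using summable_exp[of z] by (subst (asm) summable_Suc_iff[symmetric]) (intro summable_mult, simp add: field_simps)
  \<comment> \<open>For fixed \<open>s\<close>, the geometric bound on \<open>rGamma\<close> leaves
    an exponential series as majorant.\<close>
  have summable_c: "summable (\<lambda>n. norm (c n * s powr (\<rho> * real (Suc n))))" for s
  proof (rule summable_comparison_test'[OF summable_exp_Suc])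
    fix n
    define a where "a = \<rho> * real (Suc n)"
    let ?M = "exp 1 / (pi * \<kappa>)"
    have "norm (c n * s powr a) = \<bar>y\<bar> ^ Suc n / fact (Suc n) * s powr a * \<bar>rGamma a\<bar>"
      unfolding c_def a_def[symmetric] by (simp add: abs_mult power_abs)
    also have "\<dots> \<le> \<bar>y\<bar> ^ Suc n / fact (Suc n) * s powr a * (?M * sin \<theta> powr (- a))"
      using a_pos[of n] by (intro mult_left_mono abs_rGamma_le) (auto simp: a_def)
    also have "s powr a = (s powr \<rho>) ^ Suc n"
      unfolding a_def by (rule powr_times_Suc)
    also have "sin \<theta> powr (- a) = (sin \<theta> powr (- \<rho>)) ^ Suc n"
      unfolding a_def using powr_times_Suc[of "sin \<theta>" "- \<rho>" n] by (simp only: mult_minus_left)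
    also have "\<bar>y\<bar> ^ Suc n / fact (Suc n) * (s powr \<rho>) ^ Suc n * (?M * (sin \<theta> powr (- \<rho>)) ^ Suc n) =
        ?M * ((\<bar>y\<bar> * s powr \<rho> * sin \<theta> powr (- \<rho>)) ^ Suc n / fact (Suc n))"
      by (simp only: power_mult_distrib divide_inverse mult_ac)
    finally show "norm (norm (c n * s powr (\<rho> * real (Suc n)))) \<le>
        ?M * ((\<bar>y\<bar> * s powr \<rho> * sin \<theta> powr (- \<rho>)) ^ Suc n / fact (Suc n))"
      by (simp only: a_def real_norm_def abs_idempotent powr_times_Suc)
  qed
  have T_eq: "T n s = wright0 (- \<sigma>) (- s) / s * (c n * s powr (\<rho> * real (Suc n)))" if "0 < s" for n s
    using that by (simp add: T_def powr_diff)
  have suminf_T: "(\<Sum>n. T n s) = wright0 (- \<sigma>) (- s) * wright0 \<rho> (y * s powr \<rho>) / s" if "0 < s" for s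
  proof -
    have "c n * s powr (\<rho> * real (Suc n)) = (y * s powr \<rho>) ^ Suc n * rGamma (\<rho> * real (Suc n)) / fact (Suc n)" for n
      unfolding c_def powr_times_Suc by (simp only: power_mult_distrib divide_inverse mult_ac)
    then have "(\<Sum>n. c n * s powr (\<rho> * real (Suc n))) = wright0 \<rho> (y * s powr \<rho>)"
      by (simp only: wright0_def)
    then show ?thesis
      using suminf_mult[OF summable_norm_cancel[OF summable_c[of s]], of "wright0 (- \<sigma>) (- s) / s"]
      by (simp only: T_eq[OF that] times_divide_eq_left)
  qed
  have "AE s in halfline. summable (\<lambda>n. norm (T n s))"
  proof (rule AE_I2)
    fix s :: real
    assume "s \<in> space halfline"
    then have "norm (T n s) = \<bar>wright0 (- \<sigma>) (- s) / s\<bar> * norm (c n * s powr (\<rho> * real (Suc n)))" for n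
      using T_eq[of s n] by (simp only: space_halfline greaterThan_iff real_norm_def abs_mult mult.assoc)
    then show "summable (\<lambda>n. norm (T n s))"
      using summable_mult[OF summable_c] by (simp only:)
  qed
  \<comment> \<open>The decay bound majorizes each integral by a Gamma integral, whose
    \<open>Gamma a\<close> again cancels the \<open>rGamma a\<close> in \<open>c n\<close>; an
    exponential series remains.\<close>
  moreover have "summable (\<lambda>n. \<integral>s. norm (T n s) \<partial>halfline)"
  proof (rule summable_comparison_test'[OF summable_exp_Suc])
    fix n
    define a where "a = \<rho> * real (Suc n)"
    have "0 < a"
      using a_pos by (simp add: a_def)
    have int: "has_bochner_integral halfline (\<lambda>s. \<bar>c n\<bar> * K * (s powr (a - 1) * exp (- \<delta> * s)))
        (\<bar>c n\<bar> * K * (Gamma a * \<delta> powr (- a)))"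
      by (intro has_bochner_integral_mult_right Gamma_rate_real \<open>0 < a\<close> \<delta>_pos)
    have "norm (T n s) \<le> \<bar>c n\<bar> * K * (s powr (a - 1) * exp (- \<delta> * s))" if "0 \<le> s" for s
    proof -
      have "norm (T n s) = \<bar>c n\<bar> * s powr (a - 1) * \<bar>wright0 (- \<sigma>) (- s)\<bar>"
        by (simp add: T_def a_def abs_mult)
      also have "\<dots> \<le> \<bar>c n\<bar> * s powr (a - 1) * (K * exp (- \<delta> * s))"
        using abs_wright0_le[OF that] by (intro mult_left_mono) auto
      finally show ?thesis
        by (simp only: mult_ac)
    qed
    then have "(\<integral>s. norm (T n s) \<partial>halfline) \<le> (\<integral>s. \<bar>c n\<bar> * K * (s powr (a - 1) * exp (- \<delta> * s)) \<partial>halfline)"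
      using integrable_T int by (intro integral_mono integrable_norm) (auto simp: has_bochner_integral_iff)
    also have "\<dots> = \<bar>c n\<bar> * K * (Gamma a * \<delta> powr (- a))"
      using int by (rule has_bochner_integral_integral_eq)
    also have "\<bar>c n\<bar> = \<bar>y\<bar> ^ Suc n / fact (Suc n) * rGamma a"
      using Gamma_real_pos[OF \<open>0 < a\<close>]
      unfolding c_def a_def[symmetric] by (simp add: abs_mult power_abs rGamma_inverse_Gamma)
    also have "\<delta> powr (- a) = (\<delta> powr (- \<rho>)) ^ Suc n"
      unfolding a_def using powr_times_Suc[of \<delta> "- \<rho>" n] by (simp only: mult_minus_left)
    also have "\<bar>y\<bar> ^ Suc n / fact (Suc n) * rGamma a * K * (Gamma a * (\<delta> powr (- \<rho>)) ^ Suc n) =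
        (rGamma a * Gamma a) * (K * ((\<bar>y\<bar> * \<delta> powr (- \<rho>)) ^ Suc n / fact (Suc n)))"
      by (simp only: power_mult_distrib divide_inverse mult_ac)
    also have "rGamma a * Gamma a = 1"
      unfolding a_def by (rule rGamma_Gamma)
    finally show "norm (\<integral>s. norm (T n s) \<partial>halfline) \<le> K * ((\<bar>y\<bar> * \<delta> powr (- \<rho>)) ^ Suc n / fact (Suc n))"
      by simp
  qed
  ultimately have "has_bochner_integral halfline (\<lambda>s. \<Sum>n. T n s) (\<Sum>n. integral\<^sup>L halfline (T n))"
    using integrable_suminf[OF integrable_T] integral_suminf[OF integrable_T] by (simp add: has_bochner_integral_iff)
  also have "(\<Sum>n. integral\<^sup>L halfline (T n)) = wright0 (\<rho> * \<sigma>) y"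
    unfolding wright0_def by (simp only: has_bochner_integral_integral_eq[OF T_int])
  finally show ?thesis
    by (subst has_bochner_integral_cong[OF refl _ refl, symmetric]) (auto simp: suminf_T)
qed

end

theorem theorem5:
  fixes \<sigma> \<rho> x :: real
  assumes "0 < \<sigma>" and "\<sigma> < 1" and "\<rho> > 0" and "x > 0"
  shows "set_integrable lborel {0<..}
           (\<lambda>s. wright0 (- \<sigma>) (- s) * wright0 \<rho> (x * s powr \<rho>) / s) \<and>
         wright0 (\<rho> * \<sigma>) x =
           (LBINT s:{0<..}. wright0 (- \<sigma>) (- s) * wright0 \<rho> (x * s powr \<rho>) / s) \<and>
         set_integrable lborel {0<..}
           (\<lambda>s. wright0 (- \<sigma>) (- s) * wright0 \<rho> (- x * s powr \<rho>) / s) \<and>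
         wright0 (\<rho> * \<sigma>) (- x) =
           (LBINT s:{0<..}. wright0 (- \<sigma>) (- s) * wright0 \<rho> (- x * s powr \<rho>) / s)"
proof -
  \<comment> \<open>The angle must lie above \<open>pi / 2\<close> and below both \<open>pi\<close>
    and \<open>pi / (2 * \<sigma>)\<close>. With \<open>pi / (1 + \<sigma>)\<close> each of these
    inequalities reduces to \<open>0 < \<sigma>\<close> or \<open>\<sigma> < 1\<close>.\<close>
  interpret wright_ray "pi / (1 + \<sigma>)" \<sigma>
  proof
    show "pi / 2 < pi / (1 + \<sigma>)" "pi / (1 + \<sigma>) < pi" "\<sigma> * (pi / (1 + \<sigma>)) < pi / 2"
      using assms pi_gt_zero by (auto simp: field_simps)
  qed (use assms in auto)
  show ?thesis
    \<comment> \<open>The two signs are the cases \<open>y = x\<close> and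
      \<open>y = - x\<close>.\<close>
    using wright0_subordination[OF assms(3), of x] wright0_subordination[OF assms(3), of "- x"]
    unfolding has_bochner_integral_iff integrable_halfline_iff integral_halfline by (auto simp only:)
qed

end
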